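(* Let $1<p<\infty$, $q=p/(p-1)$, and let $G\colon\mathbb{R}\times\mathbb{R}\to[0,\infty)$ be given by $G(u_1,u_2)=|u_1|^p/p+|u_2|^q/q$. Then $$C_G=\frac{p\,\sin\left(\frac{\pi}{p}\right)}{2\pi\,(p-1)^{1/p}} .$$
   Context: Let $J=\begin{pmatrix}0&1\\-1&0\end{pmatrix}$. $\mathbf{L}^G([0,1],\mathbb{R}^{2})$ is the set of measurable $u\colon[0,1]\to\mathbb{R}^{2}$ with $\int_0^1G(\lambda u)\,dt<\infty$ for some $\lambda>0$ (here $u_1\in L^p$, $u_2\in L^q$). $\mathbf{W}^1_T\mathbf{L}^G([0,1],\mathbb{R}^{2})$ is the space of absolutely continuous $u\in\mathbf{L}^G$ with $\dot u\in\mathbf{L}^G$ and $u(0)=u(1)$. The constant is $$C_G=-\inf\left\{\frac{\int_0^1\langle J\dot u,u\rangle\,dt}{\int_0^1G(\dot u)\,dt}:\ u\in\mathbf{W}^1_T\mathbf{L}^G([0,1],\mathbb{R}^{2}),\ u\text{ nonconstant}\right\}.$$ *)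

theory Defs
  imports "HOL-Analysis.Analysis"
begin

text \<open>
  The plane is \<^typ>\<open>real \<times> real\<close> with its Euclidean inner product. Functions on the unit interval
  are total functions on \<^typ>\<open>real\<close>; only their values on \<^term>\<open>{0..1::real}\<close> are used.
\<close>

definition Jmap :: "real \<times> real \<Rightarrow> real \<times> real"
  where "Jmap = (\<lambda>(x, y). (y, - x))"

text \<open>
  The usual epsilon-delta notion. The members of a division are nonempty compact intervals with
  pairwise disjoint interiors, and an interval \<open>K = [x, y]\<close> of the family contributes its length
  \<open>y - x\<close> and the increment \<open>f y - f x\<close>.
\<close>

definition absolutely_continuous_on :: "real set \<Rightarrow> (real \<Rightarrow> 'a::real_normed_vector) \<Rightarrow> bool"
  where "absolutely_continuous_on S f \<longleftrightarrow>
    (\<forall>\<epsilon>>0. \<exists>\<delta>>0. \<forall>\<D>. \<D> division_of (\<Union>\<D>) \<longrightarrow> \<Union>\<D> \<subseteq> S \<longrightarrow>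
       (\<Sum>K\<in>\<D>. Sup K - Inf K) < \<delta> \<longrightarrow> (\<Sum>K\<in>\<D>. norm (f (Sup K) - f (Inf K))) < \<epsilon>)"

definition Orlicz :: "(real \<times> real \<Rightarrow> real) \<Rightarrow> (real \<Rightarrow> real \<times> real) set"
  where "Orlicz G = {u. u \<in> borel_measurable (lebesgue_on {0..1}) \<and>
    (\<exists>c>0. (\<integral>\<^sup>+t. ennreal (G (c *\<^sub>R u t)) \<partial>lebesgue_on {0..1}) < \<infinity>)}"

text \<open>
  \<^const>\<open>vector_derivative\<close> returns an unspecified value where there is no derivative. So the
  requirement that the derivative belongs to the Orlicz space is accompanied by the (redundant,
  for absolutely continuous functions) clause that the derivative exists almost everywhere.
\<close>

definition Sobolev_Orlicz_periodic :: "(real \<times> real \<Rightarrow> real) \<Rightarrow> (real \<Rightarrow> real \<times> real) set"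
  where "Sobolev_Orlicz_periodic G = {u. absolutely_continuous_on {0..1} u \<and> u \<in> Orlicz G \<and>
    (AE t in lebesgue_on {0..1}. u differentiable (at t)) \<and>
    (\<lambda>t. vector_derivative u (at t)) \<in> Orlicz G \<and> u 0 = u 1}"

text \<open>
  The infimum is taken in \<^typ>\<open>ereal\<close>, so that a finite value of the constant includes the claim that
  the quotients are bounded below; the denominator is an integral with values in \<open>[0, \<infinity>]\<close>.
\<close>

definition C_const :: "(real \<times> real \<Rightarrow> real) \<Rightarrow> ereal"
  where "C_const G =
    - (INF u \<in> {u \<in> Sobolev_Orlicz_periodic G. \<not> u constant_on {0..1}}.
         ereal (LINT t|lebesgue_on {0..1}. Jmap (vector_derivative u (at t)) \<bullet> u t) /
         enn2ereal (\<integral>\<^sup>+t. ennreal (G (vector_derivative u (at t))) \<partial>lebesgue_on {0..1}))"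

end

theory Submission
  imports Defs "HOL-Real_Asymp.Real_Asymp"
begin

text \<open>
  After integration by parts the numerator is \<open>- 2 \<integral> u\<^sub>1' (u\<^sub>2 - c)\<close> for any constant \<open>c\<close>, which Young's
  inequality bounds by \<open>\<integral> |u\<^sub>1'|\<^sup>p\<close> and \<open>\<integral> |u\<^sub>2 - c|\<^sup>q\<close>. Since \<open>u\<^sub>2\<close> is periodic, it takes some common value
  \<open>c\<close> at two times half a period apart, so \<open>w = u\<^sub>2 - c\<close> satisfies Dirichlet conditions on two
  intervals of length \<open>1/2\<close>. There the sharp inequality \<open>\<mu> \<integral> |w|\<^sup>q \<le> \<integral> |w'|\<^sup>q\<close> follows by integrating
  \<open>(|w|\<^sup>q \<psi>)' \<le> |w'|\<^sup>q - \<mu> |w|\<^sup>q\<close>, where \<open>\<psi>\<close> is a rescaled generalized tangent, the solution of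
  \<open>h' = 1 + |h|\<^sup>p\<close>. Its half period is \<open>\<integral>\<^sub>0\<^sup>\<infinity> dx / (1 + x\<^sup>p) = \<pi> / (p sin (\<pi> / p))\<close>. Equality holds for the curve
  built from the corresponding generalized sine and cosine.
\<close>

subsection \<open>Absolutely continuous functions\<close>

text \<open>Young's inequality carries a free scale: pairing \<open>u1'\<close> with
  \<open>\<mu> powr (1/q) * w\<close> bounds \<open>2 u1' w\<close> by
  \<open>C = 2 / \<mu> powr (1/q)\<close> times \<open>|u1'|^p / p + \<mu> |w|^q / q\<close>. The
  one-dimensional inequality then trades \<open>\<mu> |w|^q\<close> for \<open>|u2'|^q\<close>, so
  that exactly \<open>G\<close> appears, and the best constant asks for the largest admissible
  \<open>\<mu>\<close>. With \<open>\<mu> = k^q (p - 1)^(q - 1)\<close> the Riccati solution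
  \<open>\<psi>\<close> blows up at the ends of an interval of length \<open>2 B / k\<close>, where
  \<open>B = pi / (p sin (pi / p))\<close>. This length has to be \<open>1/2\<close>, hence
  \<open>k = 4 B\<close> and \<open>C = 2 / (4 B (p - 1)^(1/p))\<close>, the claimed value. Points
  half a period apart are chosen because they make both Dirichlet intervals equally short; a longer
  one would force a smaller \<open>\<mu>\<close>. Since the curves are merely absolutely continuous,
  the exact derivative that carries the estimate has to be integrated from its values almost
  everywhere. This is why a fundamental theorem of calculus for such functions comes first.\<close>

lemma absolutely_continuous_on_tagged:
  fixes f :: "real \<Rightarrow> 'a::real_normed_vector"
  assumes f: "absolutely_continuous_on S f" and "\<epsilon> > 0"
  obtains \<delta> where "\<delta> > 0"
    "\<And>p. p tagged_partial_division_of S \<Longrightarrow> (\<Sum>(x,K)\<in>p. measure lborel K) < \<delta> \<Longrightarrow>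
      (\<Sum>(x,K)\<in>p. norm (f (Sup K) - f (Inf K))) < \<epsilon>"
proof -
  obtain \<delta> where "\<delta> > 0" and \<delta>: "\<And>\<D>. \<D> division_of (\<Union>\<D>) \<Longrightarrow> \<Union>\<D> \<subseteq> S \<Longrightarrow>
       (\<Sum>K\<in>\<D>. Sup K - Inf K) < \<delta> \<Longrightarrow> (\<Sum>K\<in>\<D>. norm (f (Sup K) - f (Inf K))) < \<epsilon>"
    using f[unfolded absolutely_continuous_on_def, rule_format, OF \<open>\<epsilon> > 0\<close>] by blast
  show thesis
  proof
    show "\<delta> > 0" by fact
    fix p assume p: "p tagged_partial_division_of S" and len: "(\<Sum>(x,K)\<in>p. measure lborel K) < \<delta>"
    have D: "(snd ` p) division_of (\<Union>(snd ` p))"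
      using partial_division_of_tagged_division[OF p] .
    \<comment> \<open>Absolute continuity speaks of sets of intervals, the Henstock-Kurzweil
      integral of tagged ones. Two tags can share an interval only if it is degenerate, so
      quantities vanishing on degenerate intervals have the same sum in both settings.\<close>
    have over: "(\<Sum>(x,K)\<in>p. g K) = (\<Sum>K\<in>snd ` p. g K)"
      if g: "\<And>u. g {u..u} = 0" for g :: "real set \<Rightarrow> real"
    proof -
      \<comment> \<open>The lemma on sums over tagged divisions wants 0 on every box without
        interior, the empty one included, where \<open>Sup\<close> and \<open>Inf\<close> are
        unspecified. Members of \<open>p\<close> contain their tag, so the correction changes no
        term.\<close>
      define g' where "g' K = (if K = {} then 0 else g K)" for K
      have "(\<Sum>(x,K)\<in>p. g K) = (\<Sum>(x,K)\<in>p. g' K)"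
        using tagged_partial_division_ofD(2)[OF p] by (intro sum.cong) (force simp: g'_def)+
      also have "\<dots> = (\<Sum>K\<in>snd ` p. g' K)"
      proof (rule sum.over_tagged_division_lemma[OF tagged_partial_division_of_Union_self[OF p]])
        fix u v :: real
        assume "box u v = {}"
        then show "g' (cbox u v) = 0"
          using g[of u] by (cases "u = v") (auto simp: g'_def)
      qed
      also have "\<dots> = (\<Sum>K\<in>snd ` p. g K)"
        using tagged_partial_division_ofD(2)[OF p] by (intro sum.cong) (force simp: g'_def)+
      finally show ?thesis .
    qed
    have "(\<Sum>K\<in>snd ` p. Sup K - Inf K) = (\<Sum>(x,K)\<in>p. Sup K - Inf K)"
      by (rule over[symmetric]) auto
    also have "\<dots> = (\<Sum>(x,K)\<in>p. measure lborel K)"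
    proof (intro sum.cong refl, clarify)
      fix x K assume "(x, K) \<in> p"
      with p have "x \<in> K" "\<exists>a b. K = cbox a b"
        by (simp_all only: tagged_partial_division_ofD)
      then show "Sup K - Inf K = measure lborel K"
        by (auto simp: interval_bounds_real)
    qed
    finally have "(\<Sum>K\<in>snd ` p. Sup K - Inf K) < \<delta>"
      using len by simp
    moreover have "\<Union>(snd ` p) \<subseteq> S"
      using tagged_partial_division_ofD(3)[OF p] by force
    ultimately have "(\<Sum>K\<in>snd ` p. norm (f (Sup K) - f (Inf K))) < \<epsilon>"
      using \<delta>[OF D] by blast
    then show "(\<Sum>(x,K)\<in>p. norm (f (Sup K) - f (Inf K))) < \<epsilon>"
      by (subst over) auto
  qed
qed

text \<open>The intervals overlap only in null sets, so their total length is the measure of their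
  union.\<close>

lemma tagged_partial_division_content_less:
  assumes p: "p tagged_partial_division_of S" and sub: "\<And>x K. (x,K) \<in> p \<Longrightarrow> K \<subseteq> T"
    and T: "T \<in> sets lebesgue" "emeasure lebesgue T < ennreal \<delta>"
  shows "(\<Sum>(x,K)\<in>p. measure lborel (K::real set)) < \<delta>"
proof -
  have D: "(snd ` p) division_of (\<Union>(snd ` p))"
    using partial_division_of_tagged_division[OF p] .
  have T': "T \<in> lmeasurable"
    using T by (auto intro!: fmeasurableI intro: less_trans)
  have "(\<Sum>(x,K)\<in>p. measure lborel K) = (\<Sum>K\<in>snd ` p. measure lborel K)"
    by (rule sum.over_tagged_division_lemma[OF tagged_partial_division_of_Union_self[OF p]])
       (simp add: content_eq_0_interior)
  also have "\<dots> = (\<Sum>K\<in>snd ` p. measure lebesgue K)"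
    using D by (intro sum.cong) (auto simp: division_of_def)
  also have "\<dots> = measure lebesgue (\<Union>(snd ` p))"
    by (rule content_division[OF D])
  also have "\<dots> \<le> measure lebesgue T"
  proof (rule measure_mono_fmeasurable)
    show "\<Union>(snd ` p) \<subseteq> T" using sub by fastforce
    show "\<Union>(snd ` p) \<in> sets lebesgue" using lmeasurable_division[OF D] by (rule fmeasurableD)
  qed (rule T')
  also have "\<dots> < \<delta>"
    using T T' by (metis emeasure_eq_measure2 ennreal_less_iff measure_nonneg)
  finally show ?thesis .
qed

text \<open>
  The gauge confines the subintervals tagged in the exceptional null set to an open set of small
  measure, where absolute continuity controls the increments of \<open>f\<close>; at the other tags
  differentiability does.
\<close>
lemma absolutely_continuous_on_has_integral:
  fixes f :: "real \<Rightarrow> real"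
  assumes "a \<le> b" and ac: "absolutely_continuous_on {a..b} f" and N: "negligible N"
    and f': "\<And>x. x \<in> {a..b} - N \<Longrightarrow> (f has_vector_derivative f' x) (at x within {a..b})"
  shows "(f' has_integral (f b - f a)) {a..b}"
proof -
  \<comment> \<open>With the integrand set to 0 on \<open>N\<close>, an interval tagged in
    \<open>N\<close> contributes nothing but the increment of \<open>f\<close>. The final spike
    argument restores \<open>f'\<close>.\<close>
  define g where "g x = (if x \<in> N then 0 else f' x)" for x
  have "(g has_integral (f b - f a)) (cbox a b)"
    unfolding has_integral
  proof (intro allI impI)
    fix e :: real assume "e > 0"
    \<comment> \<open>Half of \<open>e\<close> is reserved for the tags in \<open>N\<close>; the
      other half pays for \<open>e1 * (b - a)\<close>. The added 1 covers
      \<open>a = b\<close>.\<close>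
    define e1 where "e1 = e / (2 * (b - a + 1))"
    have e1: "e1 > 0" using \<open>e > 0\<close> \<open>a \<le> b\<close> by (simp add: e1_def)
    have "\<forall>x. \<exists>d>0. x \<in> {a..b} - N \<longrightarrow>
         (\<forall>y\<in>{a..b}. norm (y-x) < d \<longrightarrow> norm (f y - f x - (y-x) *\<^sub>R f' x) \<le> e1 * norm (y-x))"
      using f' e1 unfolding has_vector_derivative_def has_derivative_within_alt
      by (meson gt_ex)
    then obtain d where d: "\<And>x. 0 < d x"
                   "\<And>x y. \<lbrakk>x \<in> {a..b} - N; y \<in> {a..b}; norm (y-x) < d x\<rbrakk>
                          \<Longrightarrow> norm (f y - f x - (y-x) *\<^sub>R f' x) \<le> e1 * norm (y-x)"
      by metis
    obtain \<delta> where "\<delta> > 0" and \<delta>: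
      "\<And>p. p tagged_partial_division_of {a..b} \<Longrightarrow> (\<Sum>(x,K)\<in>p. measure lborel K) < \<delta> \<Longrightarrow>
        (\<Sum>(x,K)\<in>p. norm (f (Sup K) - f (Inf K))) < e/2"
      using absolutely_continuous_on_tagged[OF ac, of "e/2"] \<open>e > 0\<close> by auto
    have Nn: "N \<in> null_sets lebesgue" using N by (simp add: negligible_iff_null_sets)
    then obtain U where U: "open U" "N \<subseteq> U" "U - N \<in> lmeasurable"
      "emeasure lebesgue (U - N) < ennreal \<delta>"
      using sets_lebesgue_outer_open[of N \<delta>] \<open>\<delta> > 0\<close> by auto
    have Um: "U \<in> sets lebesgue" using U(1) by auto
    have "emeasure lebesgue U = emeasure lebesgue (U - N)"
      using emeasure_Diff_null_set[OF Nn Um] by simp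
    then have Ue: "emeasure lebesgue U < ennreal \<delta>" using U by simp
    define \<gamma> where "\<gamma> x = (if x \<in> N then U else ball x (d x))" for x
    show "\<exists>\<gamma>. gauge \<gamma> \<and> (\<forall>\<D>. \<D> tagged_division_of cbox a b \<and> \<gamma> fine \<D> \<longrightarrow>
      norm ((\<Sum>(x, k)\<in>\<D>. measure lborel k *\<^sub>R g x) - (f b - f a)) < e)"
    proof (intro exI[of _ \<gamma>] conjI allI impI)
      show "gauge \<gamma>" using U d(1) by (auto simp: gauge_def \<gamma>_def)
      fix p assume "p tagged_division_of cbox a b \<and> \<gamma> fine p"
      then have p: "p tagged_division_of cbox a b" and fine: "\<gamma> fine p" by auto
      note pD = tagged_division_ofD[OF p]
      have fin: "finite p" by (rule pD)
      have ba: "b - a = (\<Sum>(x,K)\<in>p. Sup K - Inf K)" "f b - f a = (\<Sum>(x,K)\<in>p. f(Sup K) - f(Inf K))"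
        using additive_tagged_division_1[where f= "\<lambda>x. x"] additive_tagged_division_1[where f= f]
              \<open>a \<le> b\<close> p by auto
      have Kform: "\<exists>u v. K = {u..v} \<and> u \<le> v \<and> a \<le> u \<and> v \<le> b \<and> x \<in> {u..v} \<and> measure lborel K = v - u
          \<and> Sup K = v \<and> Inf K = u" if xK: "(x,K) \<in> p" for x K
      proof -
        obtain u v where "K = cbox u v" using pD(4)[OF xK] by blast
        moreover have "x \<in> K" "K \<subseteq> {a..b}" using pD(2,3)[OF xK] by auto
        ultimately show ?thesis by (intro exI[of _ u] exI[of _ v]) auto
      qed
      define q where "q = {xK \<in> p. fst xK \<in> N}"
      have q: "q \<subseteq> p" by (auto simp: q_def)
      have qpart: "q tagged_partial_division_of {a..b}"
        using p q tagged_partial_division_subset unfolding tagged_division_of_def by auto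
      have "(\<Sum>(x,K)\<in>q. measure lborel K) < \<delta>"
      proof (rule tagged_partial_division_content_less[OF qpart _ Um Ue])
        fix x K assume "(x,K) \<in> q"
        then show "K \<subseteq> U" using fine by (fastforce simp: q_def \<gamma>_def fine_def)
      qed
      from \<delta>[OF qpart this] have S1: "(\<Sum>(x,K)\<in>q. norm (f (Sup K) - f (Inf K))) < e/2" .
      have S2: "(\<Sum>(x,K)\<in>p-q. norm (measure lborel K *\<^sub>R g x - (f (Sup K) - f (Inf K)))) \<le> (\<Sum>(x,K)\<in>p-q. e1 * (Sup K - Inf K))"
      proof (rule sum_mono, clarify)
        fix x K assume xK: "(x,K) \<in> p" "(x,K) \<notin> q"
        then have xN: "x \<notin> N" by (auto simp: q_def)
        obtain u v where K: "K = {u..v}" "u \<le> v" "a \<le> u" "v \<le> b" "x \<in> {u..v}"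
          "measure lborel K = v - u" "Sup K = v" "Inf K = u" using Kform[OF xK(1)] by blast
        have "K \<subseteq> ball x (d x)" using fine xK xN by (fastforce simp: \<gamma>_def fine_def)
        moreover have "u \<in> K" "v \<in> K" using K by auto
        ultimately have "u \<in> ball x (d x)" "v \<in> ball x (d x)" by blast+
        then have *: "norm (f u - f x - (u-x) *\<^sub>R f' x) \<le> e1 * norm (u-x)"
          "norm (f v - f x - (v-x) *\<^sub>R f' x) \<le> e1 * norm (v-x)"
          using K(2-5) xN by (intro d(2); simp add: dist_real_def)+
        have **: "norm (u - x) = x - u" "norm (v - x) = v - x" using K by auto
        \<comment> \<open>Straddling: both endpoints are compared with the tag \<open>x\<close>
          between them, and the errors \<open>e1 * (x - u)\<close> and \<open>e1 * (v - x)\<close>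
          add up to \<open>e1\<close> times the length.\<close>
        have "measure lborel K *\<^sub>R g x - (f (Sup K) - f (Inf K)) =
          (f u - f x - (u-x) *\<^sub>R f' x) - (f v - f x - (v-x) *\<^sub>R f' x)"
          using xN K by (simp add: g_def algebra_simps)
        also have "norm \<dots> \<le> e1 * (x - u) + e1 * (v - x)"
          by (rule order_trans[OF norm_triangle_ineq4 add_mono[OF *[unfolded **]]])
        finally have "norm (measure lborel K *\<^sub>R g x - (f (Sup K) - f (Inf K))) \<le> e1 * (x - u) + e1 * (v - x)" .
        then show "norm (measure lborel K *\<^sub>R g x - (f (Sup K) - f (Inf K))) \<le> e1 * (Sup K - Inf K)"
          using K by (simp add: algebra_simps)
      qed
      have "(\<Sum>(x,K)\<in>p-q. e1 * (Sup K - Inf K)) \<le> (\<Sum>(x,K)\<in>p. e1 * (Sup K - Inf K))"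
        
      proof (rule sum_mono2)
        fix xK assume "xK \<in> p - (p - q)"
        then show "0 \<le> (case xK of (x, K) \<Rightarrow> e1 * (Sup K - Inf K))"
          using Kform[of "fst xK" "snd xK"] e1 by (cases xK) auto
      qed (use fin in auto)
      also have "\<dots> = e1 * (b - a)" unfolding ba(1) by (simp add: sum_distrib_left case_prod_unfold)
      also have "\<dots> \<le> e/2" using \<open>e > 0\<close> \<open>a \<le> b\<close> unfolding e1_def by (simp add: field_simps)
      finally have S3: "(\<Sum>(x,K)\<in>p-q. e1 * (Sup K - Inf K)) \<le> e/2" .
      have "norm ((\<Sum>(x, k)\<in>p. measure lborel k *\<^sub>R g x) - (f b - f a))
        = norm (\<Sum>(x,K)\<in>p. measure lborel K *\<^sub>R g x - (f (Sup K) - f (Inf K)))"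
        unfolding ba(2) by (simp add: sum_subtractf case_prod_unfold)
      also have "\<dots> \<le> (\<Sum>(x,K)\<in>p. norm (measure lborel K *\<^sub>R g x - (f (Sup K) - f (Inf K))))"
        by (simp add: case_prod_unfold norm_sum del: real_scaleR_def real_norm_def)
      also have "\<dots> = (\<Sum>(x,K)\<in>p-q. norm (measure lborel K *\<^sub>R g x - (f (Sup K) - f (Inf K))))
         + (\<Sum>(x,K)\<in>q. norm (measure lborel K *\<^sub>R g x - (f (Sup K) - f (Inf K))))"
        by (rule sum.subset_diff[OF q fin])
      also have "(\<Sum>(x,K)\<in>q. norm (measure lborel K *\<^sub>R g x - (f (Sup K) - f (Inf K)))) =
          (\<Sum>(x,K)\<in>q. norm (f (Sup K) - f (Inf K)))"
        by (rule sum.cong) (auto simp: q_def g_def)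
      finally show "norm ((\<Sum>(x, k)\<in>p. measure lborel k *\<^sub>R g x) - (f b - f a)) < e"
        using S1 S2 S3 by linarith
    qed
  qed
  then have "(g has_integral (f b - f a)) {a..b}" by simp
  then show ?thesis
    by (rule has_integral_spike[OF N, rotated]) (simp add: g_def)
qed

section \<open>Closure properties of absolute continuity\<close>

lemma absolutely_continuous_on_subset:
  "absolutely_continuous_on S f \<Longrightarrow> T \<subseteq> S \<Longrightarrow> absolutely_continuous_on T f"
  unfolding absolutely_continuous_on_def by (meson order_trans)

text \<open>One division tests \<open>f\<close> and \<open>g\<close> at once, so the smaller of the
  two deltas serves. Sums, products, multiples, coordinates and C1 images below are all instances of
  this domination of increments.\<close>

lemma absolutely_continuous_on_lipschitz_comb:
  fixes f :: "real \<Rightarrow> 'a::real_normed_vector" and g :: "real \<Rightarrow> 'b::real_normed_vector"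
    and h :: "real \<Rightarrow> 'c::real_normed_vector"
  assumes f: "absolutely_continuous_on S f" and g: "absolutely_continuous_on S g"
    and h: "\<And>s t. s \<in> S \<Longrightarrow> t \<in> S \<Longrightarrow> norm (h t - h s) \<le> L * (norm (f t - f s) + norm (g t - g s))"
  shows "absolutely_continuous_on S h"
  unfolding absolutely_continuous_on_def
proof (intro allI impI)
  fix \<epsilon> :: real assume "\<epsilon> > 0"
  \<comment> \<open>\<open>L\<close> may be zero or negative; \<open>M\<close> is a positive bound
    by which one can divide.\<close>
  define M where "M = \<bar>L\<bar> + 1"
  have M: "M > 0" "L \<le> M" by (auto simp: M_def)
  define e where "e = \<epsilon> / (2 * M)"
  have "e > 0" using \<open>\<epsilon> > 0\<close> M by (simp add: e_def)
  obtain d1 where d1: "d1 > 0" "\<And>\<D>. \<D> division_of (\<Union>\<D>) \<Longrightarrow> \<Union>\<D> \<subseteq> S \<Longrightarrow>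
       (\<Sum>K\<in>\<D>. Sup K - Inf K) < d1 \<Longrightarrow> (\<Sum>K\<in>\<D>. norm (f (Sup K) - f (Inf K))) < e"
    using f[unfolded absolutely_continuous_on_def, rule_format, OF \<open>e > 0\<close>] by blast
  obtain d2 where d2: "d2 > 0" "\<And>\<D>. \<D> division_of (\<Union>\<D>) \<Longrightarrow> \<Union>\<D> \<subseteq> S \<Longrightarrow>
       (\<Sum>K\<in>\<D>. Sup K - Inf K) < d2 \<Longrightarrow> (\<Sum>K\<in>\<D>. norm (g (Sup K) - g (Inf K))) < e"
    using g[unfolded absolutely_continuous_on_def, rule_format, OF \<open>e > 0\<close>] by blast
  show "\<exists>\<delta>>0. \<forall>\<D>. \<D> division_of \<Union>\<D> \<longrightarrow> \<Union>\<D> \<subseteq> S \<longrightarrow>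
    (\<Sum>K\<in>\<D>. Sup K - Inf K) < \<delta> \<longrightarrow> (\<Sum>K\<in>\<D>. norm (h (Sup K) - h (Inf K))) < \<epsilon>"
  proof (intro exI[of _ "min d1 d2"] conjI allI impI)
    show "min d1 d2 > 0" using d1 d2 by simp
    fix \<D> :: "real set set" assume D: "\<D> division_of \<Union>\<D>" "\<Union>\<D> \<subseteq> S" "(\<Sum>K\<in>\<D>. Sup K - Inf K) < min d1 d2"
    have "(\<Sum>K\<in>\<D>. norm (h (Sup K) - h (Inf K))) \<le>
      (\<Sum>K\<in>\<D>. M * (norm (f (Sup K) - f (Inf K)) + norm (g (Sup K) - g (Inf K))))"
    proof (rule sum_mono)
      fix K assume "K \<in> \<D>"
      then obtain u v where "K = cbox u v" "K \<noteq> {}" "K \<subseteq> S"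
        using division_ofD(2-4)[OF D(1)] D(2) by blast
      then have "Sup K \<in> S" "Inf K \<in> S" by (auto simp: interval_bounds_real)
      then have "norm (h (Sup K) - h (Inf K)) \<le> L * (norm (f (Sup K) - f (Inf K)) + norm (g (Sup K) - g (Inf K)))"
        using h by auto
      also have "\<dots> \<le> M * (norm (f (Sup K) - f (Inf K)) + norm (g (Sup K) - g (Inf K)))"
        using M by (intro mult_right_mono) auto
      finally show "norm (h (Sup K) - h (Inf K)) \<le> M * (norm (f (Sup K) - f (Inf K)) + norm (g (Sup K) - g (Inf K)))" .
    qed
    also have "\<dots> = M * ((\<Sum>K\<in>\<D>. norm (f (Sup K) - f (Inf K))) + (\<Sum>K\<in>\<D>. norm (g (Sup K) - g (Inf K))))"
      by (simp add: sum_distrib_left sum.distrib distrib_left)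
    also have "\<dots> < M * (e + e)"
      using d1(2)[OF D(1,2)] d2(2)[OF D(1,2)] D(3) M by (intro mult_strict_left_mono) auto
    also have "\<dots> = \<epsilon>" using M by (simp add: e_def)
    finally show "(\<Sum>K\<in>\<D>. norm (h (Sup K) - h (Inf K))) < \<epsilon>" .
  qed
qed

lemma absolutely_continuous_on_lipschitz_image:
  fixes f :: "real \<Rightarrow> 'a::real_normed_vector" and h :: "real \<Rightarrow> 'c::real_normed_vector"
  assumes f: "absolutely_continuous_on S f"
    and h: "\<And>s t. s \<in> S \<Longrightarrow> t \<in> S \<Longrightarrow> norm (h t - h s) \<le> L * norm (f t - f s)"
  shows "absolutely_continuous_on S h"
  by (rule absolutely_continuous_on_lipschitz_comb[OF f f, of _ "L/2"]) (use h in simp)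

lemma absolutely_continuous_on_id: "absolutely_continuous_on S (\<lambda>x::real. x)"
  unfolding absolutely_continuous_on_def
proof (intro allI impI)
  fix \<epsilon> :: real assume "\<epsilon> > 0"
  show "\<exists>\<delta>>0. \<forall>\<D>. \<D> division_of \<Union>\<D> \<longrightarrow> \<Union>\<D> \<subseteq> S \<longrightarrow>
    (\<Sum>K\<in>\<D>. Sup K - Inf K) < \<delta> \<longrightarrow> (\<Sum>K\<in>\<D>. norm (Sup K - Inf K)) < \<epsilon>"
  proof (intro exI[of _ \<epsilon>] conjI allI impI)
    fix \<D> :: "real set set" assume D: "\<D> division_of \<Union>\<D>" "(\<Sum>K\<in>\<D>. Sup K - Inf K) < \<epsilon>"
    have "norm (Sup K - Inf K) = Sup K - Inf K" if K: "K \<in> \<D>" for K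
    proof -
      obtain u v where "K = cbox u v" "K \<noteq> {}"
        using division_ofD(3,4)[OF D(1) K] by blast
      then show ?thesis by (auto simp: interval_bounds_real)
    qed
    then show "(\<Sum>K\<in>\<D>. norm (Sup K - Inf K)) < \<epsilon>" using D by simp
  qed fact
qed

lemma lipschitz_imp_absolutely_continuous_on:
  fixes h :: "real \<Rightarrow> 'a::real_normed_vector"
  assumes "L-lipschitz_on S h"
  shows "absolutely_continuous_on S h"
  by (rule absolutely_continuous_on_lipschitz_image[OF absolutely_continuous_on_id, of S _ L])
     (use lipschitz_onD[OF assms] in \<open>simp add: dist_norm\<close>)

lemma absolutely_continuous_on_imp_continuous_on:
  fixes f :: "real \<Rightarrow> 'a::real_normed_vector"
  assumes f: "absolutely_continuous_on {a..b} f"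
  shows "continuous_on {a..b} f"
  unfolding continuous_on_iff
proof (intro ballI allI impI)
  fix x \<epsilon> :: real assume x: "x \<in> {a..b}" and "\<epsilon> > 0"
  obtain d where d: "d > 0" "\<And>\<D>. \<D> division_of (\<Union>\<D>) \<Longrightarrow> \<Union>\<D> \<subseteq> {a..b} \<Longrightarrow>
       (\<Sum>K\<in>\<D>. Sup K - Inf K) < d \<Longrightarrow> (\<Sum>K\<in>\<D>. norm (f (Sup K) - f (Inf K))) < \<epsilon>"
    using f[unfolded absolutely_continuous_on_def, rule_format, OF \<open>\<epsilon> > 0\<close>] by blast
  have *: "norm (f t - f s) < \<epsilon>" if "s \<in> {a..b}" "t \<in> {a..b}" "s \<le> t" "t - s < d" for s t
    using d(2)[of "{{s..t}}"] division_of_self[of s t] that by (simp add: interval_bounds_real)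
  show "\<exists>d>0. \<forall>y\<in>{a..b}. dist y x < d \<longrightarrow> dist (f y) (f x) < \<epsilon>"
  proof (intro exI[of _ d] conjI ballI impI)
    fix y assume "y \<in> {a..b}" "dist y x < d"
    then show "dist (f y) (f x) < \<epsilon>"
      using *[of x y] *[of y x] x by (cases "x \<le> y") (auto simp: dist_norm norm_minus_commute)
  qed (rule d)
qed

lemma absolutely_continuous_on_bounded:
  fixes f :: "real \<Rightarrow> real"
  assumes "absolutely_continuous_on {a..b} f"
  obtains M where "\<And>x. x \<in> {a..b} \<Longrightarrow> \<bar>f x\<bar> \<le> M"
proof -
  have "bounded (f ` {a..b})"
    using absolutely_continuous_on_imp_continuous_on[OF assms]
    by (intro compact_imp_bounded compact_continuous_image) auto
  then show thesis using that unfolding bounded_iff real_norm_def by blast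
qed

lemma absolutely_continuous_on_mult:
  fixes f g :: "real \<Rightarrow> real"
  assumes f: "absolutely_continuous_on {a..b} f" and g: "absolutely_continuous_on {a..b} g"
  shows "absolutely_continuous_on {a..b} (\<lambda>x. f x * g x)"
proof -
  obtain M1 where M1: "\<And>x. x \<in> {a..b} \<Longrightarrow> \<bar>f x\<bar> \<le> M1" using absolutely_continuous_on_bounded[OF f] by blast
  obtain M2 where M2: "\<And>x. x \<in> {a..b} \<Longrightarrow> \<bar>g x\<bar> \<le> M2" using absolutely_continuous_on_bounded[OF g] by blast
  show ?thesis
  proof (rule absolutely_continuous_on_lipschitz_comb[OF f g, of _ "max M1 M2"])
    fix s t assume st: "s \<in> {a..b}" "t \<in> {a..b}"
    have "f t * g t - f s * g s = f t * (g t - g s) + g s * (f t - f s)" by algebra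
    then have "norm (f t * g t - f s * g s) \<le> \<bar>f t\<bar> * \<bar>g t - g s\<bar> + \<bar>g s\<bar> * \<bar>f t - f s\<bar>"
      by (metis abs_mult abs_triangle_ineq real_norm_def)
    also have "\<dots> \<le> max M1 M2 * \<bar>g t - g s\<bar> + max M1 M2 * \<bar>f t - f s\<bar>"
      using M1[OF st(2)] M2[OF st(1)] by (intro add_mono mult_right_mono) auto
    finally show "norm (f t * g t - f s * g s) \<le> max M1 M2 * (norm (f t - f s) + norm (g t - g s))"
      by (simp add: algebra_simps)
  qed
qed

lemma absolutely_continuous_on_add:
  fixes f g :: "real \<Rightarrow> real"
  assumes f: "absolutely_continuous_on S f" and g: "absolutely_continuous_on S g"
  shows "absolutely_continuous_on S (\<lambda>x. f x + g x)"
  by (rule absolutely_continuous_on_lipschitz_comb[OF f g, of _ 1]) auto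

lemma absolutely_continuous_on_cmult:
  fixes f :: "real \<Rightarrow> real"
  assumes f: "absolutely_continuous_on S f"
  shows "absolutely_continuous_on S (\<lambda>x. c * f x)"
  by (rule absolutely_continuous_on_lipschitz_image[OF f, of _ "\<bar>c\<bar>"])
     (simp add: abs_mult flip: right_diff_distrib)

lemma absolutely_continuous_on_fst:
  assumes f: "absolutely_continuous_on S f"
  shows "absolutely_continuous_on S (\<lambda>x. fst (f x))"
  by (rule absolutely_continuous_on_lipschitz_image[OF f, of _ 1])
     (simp flip: fst_diff, metis norm_fst_le prod.collapse)

lemma absolutely_continuous_on_snd:
  assumes f: "absolutely_continuous_on S f"
  shows "absolutely_continuous_on S (\<lambda>x. snd (f x))"
  by (rule absolutely_continuous_on_lipschitz_image[OF f, of _ 1])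
     (simp flip: snd_diff, metis norm_snd_le prod.collapse)

lemma C1_imp_absolutely_continuous_on:
  fixes f f' :: "real \<Rightarrow> real"
  assumes "\<And>x. x \<in> {a..b} \<Longrightarrow> (f has_real_derivative f' x) (at x within {a..b})"
    and "continuous_on {a..b} f'"
  shows "absolutely_continuous_on {a..b} f"
proof -
  have "bounded (f' ` {a..b})"
    using assms(2) by (intro compact_imp_bounded compact_continuous_image) auto
  then obtain M where M: "\<And>x. x \<in> {a..b} \<Longrightarrow> norm (f' x) \<le> M" "M > 0"
    unfolding bounded_pos by blast
  have "M-lipschitz_on {a..b} f"
  proof (rule lipschitz_onI)
    fix x y assume "x \<in> {a..b}" "y \<in> {a..b}"
    then show "dist (f x) (f y) \<le> M * dist x y"
      unfolding dist_norm
      by (intro field_differentiable_bound[of "{a..b}" f f' M]) (use assms M in auto)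
  qed (use M in simp)
  then show ?thesis by (rule lipschitz_imp_absolutely_continuous_on)
qed

text \<open>A C1 function is Lipschitz on bounded sets, and the range of \<open>f\<close> is
  bounded. The intended \<open>g\<close> is \<open>|x - c| powr q\<close>, which is not globally
  Lipschitz.\<close>

lemma absolutely_continuous_on_compose_C1:
  fixes f g g' :: "real \<Rightarrow> real"
  assumes f: "absolutely_continuous_on {a..b} f"
    and g: "\<And>x. (g has_real_derivative g' x) (at x)" "continuous_on UNIV g'"
  shows "absolutely_continuous_on {a..b} (\<lambda>x. g (f x))"
proof -
  obtain M where M: "\<And>x. x \<in> {a..b} \<Longrightarrow> \<bar>f x\<bar> \<le> M" using absolutely_continuous_on_bounded[OF f] by blast
  have "bounded (g' ` {-M..M})"
    using g(2) by (intro compact_imp_bounded compact_continuous_image) (auto intro: continuous_on_subset)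
  then obtain L where L: "\<And>x. x \<in> {-M..M} \<Longrightarrow> norm (g' x) \<le> L" "L > 0"
    unfolding bounded_pos by blast
  show ?thesis
  proof (rule absolutely_continuous_on_lipschitz_image[OF f, of _ L])
    fix s t assume "s \<in> {a..b}" "t \<in> {a..b}"
    then have "f s \<in> {-M..M}" "f t \<in> {-M..M}" using M by (force simp: abs_le_iff)+
    then show "norm (g (f t) - g (f s)) \<le> L * norm (f t - f s)"
      by (intro field_differentiable_bound[of "{-M..M}" g g' L])
        (use L g in \<open>auto intro: has_field_derivative_at_within\<close>)

  qed
qed

subsection \<open>Generalized trigonometric functions\<close>

text \<open>With exponent \<open>r - 1\<close> this is the nonlinearity \<open>|x|^(r-2) x\<close>
  of the p-Laplacian, written so that it is 0 at the origin also for \<open>r < 2\<close>.\<close>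

definition sgn_powr :: "real \<Rightarrow> real \<Rightarrow> real"
  where "sgn_powr x r = sgn x * \<bar>x\<bar> powr r"

lemma DERIV_abs_powr:
  assumes "1 < r"
  shows "((\<lambda>x. \<bar>x\<bar> powr r) has_real_derivative r * sgn_powr x (r - 1)) (at x)"
proof -
  consider "x > 0" | "x < 0" | "x = 0" by linarith
  then show ?thesis
  proof cases
    case 1
    have "((\<lambda>x. x powr r) has_real_derivative r * sgn_powr x (r - 1)) (at x)"
      using 1 by (auto intro!: derivative_eq_intros simp: sgn_powr_def)
    then show ?thesis
      by (rule has_field_derivative_transform_within_open[of _ _ _ "{0<..}"]) (use 1 in auto)
  next
    case 2
    have "((\<lambda>x. (-x) powr r) has_real_derivative r * sgn_powr x (r - 1)) (at x)"
      using 2 by (auto intro!: derivative_eq_intros simp: sgn_powr_def)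
    then show ?thesis
      by (rule has_field_derivative_transform_within_open[of _ _ _ "{..<0}"]) (use 2 in auto)
  next
    case 3
    \<comment> \<open>At the origin the difference quotient has modulus
      \<open>|h| powr (r - 1)\<close>, which tends to 0 because \<open>1 < r\<close>.\<close>
    have "((\<lambda>h. \<bar>h\<bar> powr (r - 1)) \<longlongrightarrow> \<bar>0\<bar> powr (r - 1)) (at 0)"
      using assms by (intro tendsto_intros) auto
    then have "((\<lambda>h. \<bar>h\<bar> powr (r - 1)) \<longlongrightarrow> 0) (at 0)" by simp
    then have "((\<lambda>h. \<bar>h\<bar> powr r / h) \<longlongrightarrow> 0) (at (0::real))"
    proof (rule Lim_null_comparison[rotated])
      have "norm (\<bar>h\<bar> powr r / h) = \<bar>h\<bar> powr (r - 1)" if "h \<noteq> 0" for h :: real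
        using that by (simp add: powr_diff)
      then show "\<forall>\<^sub>F h in at 0. norm (\<bar>h\<bar> powr r / h) \<le> \<bar>h\<bar> powr (r - 1)"
        by (auto simp: eventually_at intro!: exI[of _ 1])
    qed
    then show ?thesis using 3 by (simp add: has_field_derivative_iff sgn_powr_def)
  qed
qed

lemma continuous_on_sgn_powr [continuous_intros]:
  assumes "0 < r" "continuous_on S f"
  shows "continuous_on S (\<lambda>x. sgn_powr (f x) r)"
proof -
  have "isCont (\<lambda>x. sgn_powr x r) x" for x
  proof -
    consider "x > 0" | "x < 0" | "x = 0" by linarith
    then show ?thesis
    proof cases
      case 1
      have "isCont (\<lambda>x. x powr r) x" using 1 by (intro continuous_intros) auto
      moreover have "\<forall>\<^sub>F y in nhds x. sgn_powr y r = y powr r"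
        using eventually_nhds_in_open[of "{0<..}" x] 1 by (auto elim!: eventually_mono simp: sgn_powr_def)
      ultimately show ?thesis by (simp add: isCont_cong)
    next
      case 2
      have "isCont (\<lambda>x. - ((-x) powr r)) x" using 2 by (intro continuous_intros) auto
      moreover have "\<forall>\<^sub>F y in nhds x. sgn_powr y r = - ((-y) powr r)"
        using eventually_nhds_in_open[of "{..<0}" x] 2 by (auto elim!: eventually_mono simp: sgn_powr_def)
      ultimately show ?thesis by (simp add: isCont_cong)
    next
      case 3
      have "((\<lambda>h. \<bar>h\<bar> powr r) \<longlongrightarrow> \<bar>0\<bar> powr r) (at (0::real))"
        using assms by (intro tendsto_intros) auto
      then have "((\<lambda>h. sgn_powr h r) \<longlongrightarrow> 0) (at 0)"
        using assms by (intro Lim_null_comparison[of "\<lambda>h. sgn_powr h r" "\<lambda>h. \<bar>h\<bar> powr r"])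
          (auto simp: sgn_powr_def abs_mult abs_sgn_eq)
      then show ?thesis using 3 by (simp add: isCont_def sgn_powr_def)
    qed
  qed
  then have "continuous_on UNIV (\<lambda>x. sgn_powr x r)"
    by (simp add: continuous_at_imp_continuous_on)
  from continuous_on_compose2[OF this assms(2)] show ?thesis by simp
qed

lemma abs_sgn_powr [simp]: "\<bar>sgn_powr x r\<bar> = \<bar>x\<bar> powr r"
  by (simp add: sgn_powr_def abs_mult abs_sgn_eq)

lemma sgn_powr_minus: "sgn_powr (- x) r = - sgn_powr x r"
  by (simp add: sgn_powr_def sgn_minus)

lemma sgn_powr_mult_self: "x * sgn_powr x (r - 1) = \<bar>x\<bar> powr r"
  by (cases "x = 0") (auto simp: sgn_powr_def powr_diff abs_sgn_eq sgn_if)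

text \<open>Evaluates \<open>Beta (1/p) (1 - 1/p)\<close>, whose Gamma denominator is
  \<open>Gamma 1 = 1\<close>. This is the origin of the sine in the constant.\<close>

lemma Gamma_reflection_real_inverse:
  fixes x :: real
  assumes "0 < x" "x < 1"
  shows "Gamma x * Gamma (1 - x) = pi / sin (pi * x)"
proof -
  have "complex_of_real (Gamma x * Gamma (1 - x)) = Gamma (of_real x) * Gamma (1 - of_real x)"
    by (simp flip: Gamma_complex_of_real)
  also have "\<dots> = of_real (pi / sin (pi * x))"
    using Gamma_reflection_complex[of "of_real x"] by (simp flip: sin_of_real)
  finally show ?thesis using of_real_eq_iff by blast
qed

lemma Young_powr:
  fixes a b p q :: real
  assumes "1 < p" "q = p / (p - 1)"
  shows "a * b \<le> \<bar>a\<bar> powr p / p + \<bar>b\<bar> powr q / q"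
proof -
  have "1 < q" "1/p + 1/q = 1" using assms by (auto simp: less_divide_eq diff_divide_distrib)
  then have "\<bar>a\<bar> * \<bar>b\<bar> \<le> \<bar>a\<bar> powr p / p + \<bar>b\<bar> powr q / q"
    using assms by (intro Youngs_inequality) auto
  then show ?thesis using abs_le_D1[of "a * b"] by (simp add: abs_mult)
qed

lemma sin_pi_divide_pos: "1 < p \<Longrightarrow> 0 < sin (pi / p)" for p :: real
  by (rule sin_gt_zero) (auto simp: field_simps)

section \<open>Generalized arctangent, tangent, sine and cosine\<close>

text \<open>For \<open>p = 2\<close> this is \<open>arctan\<close>, with limit
  \<open>pi / 2\<close>. The absolute value makes the integrand even and hence \<open>F\<close> odd;
  the limit is a complete Beta integral.\<close>

lemma generalized_arctan_exists:
  fixes p :: real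
  assumes "1 < p"
  obtains F where "F 0 = 0" "\<And>x. (F has_real_derivative 1 / (1 + \<bar>x\<bar> powr p)) (at x)"
    "\<And>x. F (- x) = - F x" "(F \<longlongrightarrow> pi / (p * sin (pi / p))) at_top"
proof -
  have pos: "1 + \<bar>x\<bar> powr p > 0" for x :: real by (simp add: add_pos_nonneg)
  have "\<exists>F. \<forall>x::real. -\<infinity> < ereal x \<longrightarrow> ereal x < \<infinity> \<longrightarrow>
      (F has_vector_derivative 1 / (1 + \<bar>x\<bar> powr p)) (at x)"
  proof (rule einterval_antiderivative)
    fix x :: real
    show "isCont (\<lambda>x. 1 / (1 + \<bar>x\<bar> powr p)) x"
      using assms pos[of x] by (intro continuous_intros) auto
  qed simp
  then obtain F0 where F0: "\<And>x. (F0 has_real_derivative 1 / (1 + \<bar>x\<bar> powr p)) (at x)"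
    by (auto simp: has_real_derivative_iff_has_vector_derivative)
  define F where "F x = F0 x - F0 0" for x
  have F: "(F has_real_derivative 1 / (1 + \<bar>x\<bar> powr p)) (at x)" for x
    unfolding F_def using F0[of x] by (auto intro!: derivative_eq_intros)
  have F_0: "F 0 = 0" by (simp add: F_def)
  have odd: "F (- x) = - F x" for x
  proof -
    have "((\<lambda>x. F (- x) + F x) has_real_derivative 0) (at x)" for x
    proof -
      have "((\<lambda>x. F (- x)) has_real_derivative 1 / (1 + \<bar>- x\<bar> powr p) * (- 1)) (at x)"
        by (rule DERIV_chain2[OF F]) (auto intro!: derivative_eq_intros)
      from DERIV_add[OF this F[of x]] show ?thesis by simp
    qed
    then have "F (- x) + F x = F (- 0) + F 0"
      using DERIV_isconst_all[of "\<lambda>x. F (- x) + F x"] by blast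
    then show ?thesis using F_0 by simp
  qed
  \<comment> \<open>The substitution \<open>y = x\<^sup>p / (1 + x\<^sup>p)\<close> turns \<open>F\<close> into an incomplete Beta integral.\<close>
  define f where "f t = t powr (1/p - 1) * (1 - t) powr ((1 - 1/p) - 1)" for t :: real
  define b where "b y = integral {0..y} f" for y
  define y where "y x = x powr p / (1 + x powr p)" for x :: real
  have f: "(f has_integral Beta (1/p) (1 - 1/p)) {0..1}"
    unfolding f_def using assms by (intro has_integral_Beta_real) auto
  then have fi: "f integrable_on {0..1}" by blast
  have Beta: "Beta (1/p) (1 - 1/p) = pi / sin (pi / p)"
    using Gamma_reflection_real_inverse[of "1/p"] assms by (simp add: Beta_def)
  have b_cont: "continuous_on {0..1} b"
    unfolding b_def using fi by (rule indefinite_integral_continuous_1)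
  have b_deriv: "(b has_real_derivative f z) (at z)" if z: "0 < z" "z < 1" for z
  proof -
    have "(b has_vector_derivative f z) (at z within {0..1})"
      unfolding b_def
    proof (rule integral_has_vector_derivative_continuous_at[OF fi, where S = "{}", simplified])
      show "0 \<le> z \<and> z \<le> 1" using z by simp
      have "isCont f z" unfolding f_def using z by (intro continuous_intros) auto
      then show "continuous (at z within {0..1}) f" by (rule continuous_at_imp_continuous_at_within)
    qed
    then show ?thesis
      using z by (simp add: has_real_derivative_iff_has_vector_derivative at_within_Icc_at)
  qed
  have F_b: "F x = b (y x) / p" if "x > 0" for x
  proof -
    \<comment> \<open>\<open>f\<close> has a negative exponent at 0, so \<open>b\<close> is
      differentiated only at interior points. Continuity of \<open>b\<close> and \<open>y\<close> up
      to the endpoint suffices to identify the constant.\<close>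
    have "F x - b (y x) / p = F 0 - b (y 0) / p"
    proof (rule DERIV_isconst_end[OF that])
      have "continuous_on {0..x} y"
        unfolding y_def using assms
        by (intro continuous_on_divide continuous_on_add continuous_on_powr' continuous_on_const
            continuous_on_id) (auto simp: add_nonneg_eq_0_iff)
      moreover have "y ` {0..x} \<subseteq> {0..1}"
        unfolding y_def by (auto simp: divide_le_eq_1 add_pos_nonneg)
      moreover have "continuous_on {0..x} F"
        using F by (meson DERIV_continuous continuous_at_imp_continuous_on)
      ultimately show "continuous_on {0..x} (\<lambda>x. F x - b (y x) / p)"
        using assms by (intro continuous_intros continuous_on_compose2[OF b_cont]) auto
    next
      fix t assume t: "0 < t" "t < x"
      define P where "P = t powr p"
      have P: "P > 0" using t by (simp add: P_def)
      have yt: "0 < y t" "y t < 1" using P by (auto simp: y_def P_def[symmetric])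
      have tp: "t powr (p - 1) = P / t" using t by (simp add: P_def powr_diff)
      have dy: "(y has_real_derivative p * (P / t) / (1 + P)\<^sup>2) (at t)"
        unfolding y_def using t P
        by (auto intro!: derivative_eq_intros simp: P_def[symmetric] tp field_simps power2_eq_square)
      have "1 - y t = 1 / (1 + P)" using P by (simp add: y_def P_def[symmetric] field_simps)
      then have "f (y t) = (P / (1 + P)) powr (1/p - 1) * (1 / (1 + P)) powr (- 1 / p)"
        unfolding f_def by (simp add: y_def P_def[symmetric])
      also have "\<dots> = P powr (1/p - 1) * ((1 / (1 + P)) powr (1/p - 1) * (1 / (1 + P)) powr (- 1 / p))"
        using P by (simp add: powr_mult flip: powr_mult[of P "1/(1+P)", simplified])
      also have "(1 / (1 + P)) powr (1/p - 1) * (1 / (1 + P)) powr (- 1 / p) = (1 / (1 + P)) powr (-1)"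
        by (simp flip: powr_add)
      also have "\<dots> = 1 + P" using P by (simp add: powr_minus)
      also have "P powr (1/p - 1) = t / P" using t assms by (simp add: P_def powr_diff powr_powr)
      finally have fy: "f (y t) = t / P * (1 + P)" .
      have "((\<lambda>x. b (y x)) has_real_derivative f (y t) * (p * (P / t) / (1 + P)\<^sup>2)) (at t)"
        by (rule DERIV_chain2[OF b_deriv[OF yt] dy])
      also have "f (y t) * (p * (P / t) / (1 + P)\<^sup>2) = p * (1 / (1 + \<bar>t\<bar> powr p))"
      proof -
        have "t / P * Q * (p * (P / t) / Q\<^sup>2) = p * (1 / Q)" if "Q \<noteq> 0" for Q
          using that t P by (simp add: power2_eq_square)
        from this[of "1 + P"] show ?thesis
          unfolding fy using t P by (simp add: P_def[symmetric])
      qed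
      finally have "((\<lambda>x. b (y x) / p) has_real_derivative 1 / (1 + \<bar>t\<bar> powr p)) (at t)"
        using assms by (auto intro!: derivative_eq_intros)
      from DERIV_diff[OF F this] show "((\<lambda>x. F x - b (y x) / p) has_real_derivative 0) (at t)"
        by simp
    qed
    then show ?thesis by (simp add: F_0 y_def b_def)
  qed
  have lim_y: "(y \<longlongrightarrow> 1) at_top"
    unfolding y_def using assms by real_asymp
  have "((\<lambda>x. b (y x) / p) \<longlongrightarrow> b 1 / p) at_top"
  proof (intro tendsto_divide tendsto_const)
    show "((\<lambda>x. b (y x)) \<longlongrightarrow> b 1) at_top"
    proof (rule continuous_on_tendsto_compose[OF b_cont lim_y])
      show "\<forall>\<^sub>F x in at_top. y x \<in> {0..1}"
        by (intro always_eventually) (auto simp: y_def divide_le_eq_1 add_pos_nonneg)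
    qed simp
  qed (use assms in simp)
  moreover have "b 1 / p = pi / (p * sin (pi / p))"
    using f unfolding b_def by (simp add: integral_unique Beta)
  moreover have "\<forall>\<^sub>F x in at_top. b (y x) / p = F x"
    using eventually_gt_at_top[of 0] by eventually_elim (simp add: F_b)
  ultimately have "(F \<longlongrightarrow> pi / (p * sin (pi / p))) at_top"
    using Lim_transform_eventually by force
  then show thesis using that[OF F_0 F odd] by blast
qed

text \<open>Inverting the generalized arctangent turns \<open>F' = 1 / (1 + |x|^p)\<close> into an
  autonomous equation, and the limits of \<open>F\<close> at infinity become the blow-up times. For
  \<open>p = 2\<close> the function is \<open>tan\<close>.\<close>

lemma generalized_tan_exists:
  fixes p B :: real
  assumes "1 < p" and B: "B = pi / (p * sin (pi / p))"
  obtains h where "\<And>t. \<bar>t\<bar> < B \<Longrightarrow> (h has_real_derivative 1 + \<bar>h t\<bar> powr p) (at t)"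
    "filterlim h at_top (at_left B)" "filterlim h at_bot (at_right (- B))"
proof -
  obtain F where F0: "F 0 = 0" and F: "\<And>x. (F has_real_derivative 1 / (1 + \<bar>x\<bar> powr p)) (at x)"
    and odd: "\<And>x. F (- x) = - F x" and lim: "(F \<longlongrightarrow> B) at_top"
    unfolding B using generalized_arctan_exists[OF assms(1)] by blast
  have pos: "1 + \<bar>x\<bar> powr p > 0" for x :: real by (simp add: add_pos_nonneg)
  have mono: "F x < F y" if "x < y" for x y
    using that F pos by (intro DERIV_pos_imp_increasing[OF that]) (metis divide_pos_pos zero_less_one)
  then have smono: "strict_mono F" by (simp add: strict_mono_def)
  have cont: "isCont F x" for x using F DERIV_isCont by blast
  have less_B: "F x < B" for x
  proof -
    have "F (x + 1) \<le> B"
    proof (rule tendsto_lowerbound[OF lim])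
      show "\<forall>\<^sub>F y in at_top. F (x + 1) \<le> F y"
        using eventually_gt_at_top[of "x+1"] by eventually_elim (simp add: mono less_imp_le)
    qed simp
    then show ?thesis using mono[of x "x+1"] by simp
  qed
  have gr_B: "- B < F x" for x using less_B[of "- x"] odd[of x] by simp
  have ex: "\<exists>x. F x = t" if t: "\<bar>t\<bar> < B" for t
  proof -
    have "\<forall>\<^sub>F x in at_top. \<bar>t\<bar> < F x"
      using order_tendstoD(1)[OF lim t] .
    then obtain x where x: "\<bar>t\<bar> < F x" by (meson eventually_happens trivial_limit_at_top_linorder)
    have "x > 0" using x F0 smono by (metis abs_ge_zero le_less_trans strict_mono_less)
    moreover have "F (- x) \<le> t" "t \<le> F x" using x odd by auto
    ultimately have "\<exists>z\<ge>-x. z \<le> x \<and> F z = t"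
      by (intro IVT) (auto simp: cont)
    then show ?thesis by blast
  qed
  \<comment> \<open>\<open>F\<close> maps onto \<open>(-B, B)\<close> only; elsewhere
    \<open>inv F\<close> is unspecified, so every claim about \<open>h\<close> is confined to that
    interval.\<close>
  define h where "h = inv F"
  have hF: "h (F x) = x" for x
    unfolding h_def by (rule inv_f_f) (use smono strict_mono_imp_inj_on in blast)
  have Fh: "F (h t) = t" if "\<bar>t\<bar> < B" for t using ex[OF that] hF by metis
  have h_mono: "x < h t" if "F x < t" "\<bar>t\<bar> < B" for x t
    using Fh[OF that(2)] that(1) smono by (metis strict_mono_less)
  have h_mono': "h t < x" if "t < F x" "\<bar>t\<bar> < B" for x t
    using Fh[OF that(2)] that(1) smono by (metis strict_mono_less)
  show thesis
  proof
    fix t :: real assume t: "\<bar>t\<bar> < B"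
    have "isCont h (F (h t))"
      by (rule isCont_inverse_function[of 1]) (auto simp: hF cont)
    then have c: "isCont h t" using Fh[OF t] by simp
    have "(h has_real_derivative inverse (1 / (1 + \<bar>h t\<bar> powr p))) (at t)"
      by (rule DERIV_inverse_function[where a = "-B" and b = B, OF F _ _ _ _ c])
        (use t pos[of "h t"] Fh in \<open>auto simp: abs_less_iff\<close>)
    then show "(h has_real_derivative 1 + \<bar>h t\<bar> powr p) (at t)" by simp
  next
    show "filterlim h at_top (at_left B)"
      unfolding filterlim_at_top
    proof
      fix Z
      have "\<forall>\<^sub>F t in at_left B. t \<in> {max 0 (F Z)<..<B}"
        using eventually_at_left_real[of "max 0 (F Z)" B] less_B[of Z] less_B[of 0] F0 by simp
      then show "\<forall>\<^sub>F t in at_left B. Z \<le> h t"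
        by eventually_elim (intro less_imp_le h_mono, auto)
    qed
  next
    show "filterlim h at_bot (at_right (- B))"
      unfolding filterlim_at_bot
    proof
      fix Z
      have "\<forall>\<^sub>F t in at_right (- B). t \<in> {- B<..<min 0 (F Z)}"
        using eventually_at_right_real[of "- B" "min 0 (F Z)"] gr_B[of Z] gr_B[of 0] F0 by simp
      then show "\<forall>\<^sub>F t in at_right (- B). h t \<le> Z"
        by eventually_elim (intro less_imp_le h_mono', auto)
    qed
  qed
qed

text \<open>The tangent blows up at the ends of its interval, but these two functions of it stay
  bounded and extend continuously. For \<open>p = 2\<close> they are sine and cosine; in general the
  Pythagorean identity has the two conjugate exponents.\<close>

lemma generalized_sine_cosine_exist:
  fixes p q B :: real
  assumes p: "1 < p" and q: "q = p / (p - 1)" and B: "B = pi / (p * sin (pi / p))"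
  obtains s c :: "real \<Rightarrow> real" where
    "\<And>t. \<bar>t\<bar> < B \<Longrightarrow> (s has_real_derivative c t powr (q - 1)) (at t)"
    "\<And>t. \<bar>t\<bar> < B \<Longrightarrow> (c has_real_derivative - (p - 1) * sgn_powr (s t) (p - 1)) (at t)"
    "continuous_on {- B..B} s" "continuous_on {- B..B} c"
    "s (- B) = - 1" "s B = 1" "c (- B) = 0" "c B = 0"
    "\<And>t. c t \<ge> 0" "\<And>t. \<bar>s t\<bar> powr p + c t powr q = 1"
proof -
  obtain h where h: "\<And>t. \<bar>t\<bar> < B \<Longrightarrow> (h has_real_derivative 1 + \<bar>h t\<bar> powr p) (at t)"
    and h_top: "filterlim h at_top (at_left B)" and h_bot: "filterlim h at_bot (at_right (- B))"
    using generalized_tan_exists[OF p B] by blast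
  have "B > 0" using p sin_pi_divide_pos[OF p] by (simp add: B)
  have q1: "1 < q" using p by (auto simp: q field_simps)
  define D where "D x = 1 + \<bar>x\<bar> powr p" for x :: real
  have D: "D x > 0" "D x \<noteq> 0" for x by (simp_all add: D_def add_pos_nonneg add_nonneg_eq_0_iff)
  \<comment> \<open>\<open>s\<close> and \<open>c\<close> are \<open>\<sigma>\<close> and \<open>\<gamma>\<close> of the generalized tangent, as sine and cosine are of \<open>tan\<close>.\<close>
  define \<sigma> where "\<sigma> x = x * D x powr (- 1 / p)" for x
  define \<gamma> where "\<gamma> x = D x powr (- 1 / q)" for x
  have id: "\<bar>\<sigma> x\<bar> powr p + \<gamma> x powr q = 1" for x
  proof -
    have "\<bar>\<sigma> x\<bar> powr p = \<bar>x\<bar> powr p / D x" "\<gamma> x powr q = 1 / D x"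
    proof -
      have "(D x powr (- 1 / r)) powr r = 1 / D x" if "r > 0" for r
        unfolding powr_powr using that D[of x] by (simp add: powr_minus_divide)
      from this[of p] this[of q] show "\<bar>\<sigma> x\<bar> powr p = \<bar>x\<bar> powr p / D x" "\<gamma> x powr q = 1 / D x"
        using p q1 by (simp_all add: \<sigma>_def \<gamma>_def abs_mult powr_mult)
    qed
    then show ?thesis using D[of x] by (simp add: D_def add_divide_distrib[symmetric] add.commute)
  qed
  have dD: "(D has_real_derivative p * sgn_powr x (p - 1)) (at x)" for x
    unfolding D_def using DERIV_add[OF DERIV_const DERIV_abs_powr[OF p]] by simp
  have dDr: "((\<lambda>x. D x powr r) has_real_derivative r * D x powr (r - 1) * (p * sgn_powr x (p - 1))) (at x)" for x r
    using DERIV_fun_powr[OF dD D(1)] by simp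
  \<comment> \<open>The factor \<open>1 / D x\<close>, here and for \<open>\<gamma>\<close>, is
    cancelled in the chain rule by \<open>h' = D (h t)\<close>.\<close>
  have d\<sigma>: "(\<sigma> has_real_derivative \<gamma> x powr (q - 1) / D x) (at x)" for x
  proof -
    have "(\<sigma> has_real_derivative D x powr (- 1 / p) + x * (- 1 / p * D x powr (- 1 / p - 1) * (p * sgn_powr x (p - 1)))) (at x)"
      unfolding \<sigma>_def by (rule DERIV_cong[OF DERIV_mult[OF DERIV_ident dDr]]) simp
    moreover have "D x powr (- 1 / p) + x * (- 1 / p * D x powr (- 1 / p - 1) * (p * sgn_powr x (p - 1)))
      = D x powr (- 1 / p) - D x powr (- 1 / p) / D x * (x * sgn_powr x (p - 1))"
      using p D[of x] by (simp add: powr_diff)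
    moreover have "\<dots> = D x powr (- 1 / p) / D x * (D x - \<bar>x\<bar> powr p)"
      using D[of x] by (simp add: sgn_powr_mult_self right_diff_distrib)
    moreover have "D x - \<bar>x\<bar> powr p = 1" by (simp add: D_def)
    moreover have "\<gamma> x powr (q - 1) = D x powr (- 1 / p)"
    proof -
      have "- 1 / q * (q - 1) = - 1 / p" using p by (simp add: q field_simps)
      then show ?thesis by (simp add: \<gamma>_def powr_powr)
    qed
    ultimately show ?thesis by simp
  qed
  have d\<gamma>: "(\<gamma> has_real_derivative - (p - 1) * sgn_powr (\<sigma> x) (p - 1) / D x) (at x)" for x
  proof -
    have "(\<gamma> has_real_derivative - 1 / q * D x powr (- 1 / q - 1) * (p * sgn_powr x (p - 1))) (at x)"
      unfolding \<gamma>_def by (rule dDr)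
    moreover have 2: "sgn_powr (\<sigma> x) (p - 1) = sgn_powr x (p - 1) * D x powr (- 1 / q)"
    proof -
      have "- 1 / p * (p - 1) = - 1 / q" using p by (simp add: q field_simps)
      then show ?thesis
        using D[of x] by (simp add: \<sigma>_def sgn_powr_def sgn_mult abs_mult powr_mult powr_powr)
    qed
    moreover have "- 1 / q * D x powr (- 1 / q - 1) * (p * X) = - (p - 1) * (X * D x powr (- 1 / q)) / D x" for X
    proof -
      have "p - 1 = p / q" using p by (simp add: q)
      then show ?thesis using D[of x] by (simp add: powr_diff)
    qed
    ultimately show ?thesis by simp
  qed
  \<comment> \<open>The limits \<open>-1\<close>, \<open>1\<close> and \<open>0\<close> continue
    \<open>s\<close> and \<open>c\<close> beyond the endpoints, so that the Pythagorean identity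
    holds for all real \<open>t\<close>.\<close>
  define s where "s t = (if t \<le> - B then - 1 else if t < B then \<sigma> (h t) else 1)" for t
  define c where "c t = (if \<bar>t\<bar> < B then \<gamma> (h t) else 0)" for t
  have s_in: "s t = \<sigma> (h t)" and c_in: "c t = \<gamma> (h t)" if "\<bar>t\<bar> < B" for t
    using that by (auto simp: s_def c_def)
  have ds: "(s has_real_derivative c t powr (q - 1)) (at t)" if t: "\<bar>t\<bar> < B" for t
  proof -
    have "((\<lambda>t. \<sigma> (h t)) has_real_derivative c t powr (q - 1)) (at t)"
      using DERIV_chain2[OF d\<sigma> h[OF t]] D[of "h t"] by (simp add: c_in[OF t] D_def[symmetric])
    then show ?thesis
      by (rule has_field_derivative_transform_within_open[of _ _ _ "{-B<..<B}"]) (use t in \<open>auto simp: s_in\<close>)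
  qed
  have dc: "(c has_real_derivative - (p - 1) * sgn_powr (s t) (p - 1)) (at t)" if t: "\<bar>t\<bar> < B" for t
  proof -
    have "((\<lambda>t. \<gamma> (h t)) has_real_derivative - (p - 1) * sgn_powr (s t) (p - 1)) (at t)"
      using DERIV_chain2[OF d\<gamma> h[OF t]] D[of "h t"] by (simp add: s_in[OF t] D_def[symmetric])
    then show ?thesis
      by (rule has_field_derivative_transform_within_open[of _ _ _ "{-B<..<B}"]) (use t in \<open>auto simp: c_in\<close>)
  qed
  have "((\<lambda>x. x * (1 + x powr p) powr (- 1 / p)) \<longlongrightarrow> 1) at_top"
    using p by real_asymp
  moreover have "\<forall>\<^sub>F x in at_top. x * (1 + x powr p) powr (- 1 / p) = \<sigma> x"
    using eventually_ge_at_top[of 0] by eventually_elim (simp add: \<sigma>_def D_def)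
  ultimately have \<sigma>_top: "(\<sigma> \<longlongrightarrow> 1) at_top" by (rule Lim_transform_eventually)
  have \<sigma>_bot: "(\<sigma> \<longlongrightarrow> - 1) at_bot"
  proof -
    have "((\<lambda>x. \<sigma> (- x)) \<longlongrightarrow> - 1) at_top"
      using tendsto_minus[OF \<sigma>_top] by (simp add: \<sigma>_def D_def)
    then show ?thesis by (simp add: filterlim_at_bot_mirror)
  qed
  have "((\<lambda>x. (1 + x powr p) powr (- 1 / q)) \<longlongrightarrow> 0) at_top"
    using p q1 by real_asymp
  moreover have "\<forall>\<^sub>F x in at_top. (1 + x powr p) powr (- 1 / q) = \<gamma> x"
    using eventually_ge_at_top[of 0] by eventually_elim (simp add: \<gamma>_def D_def)
  ultimately have \<gamma>_top: "(\<gamma> \<longlongrightarrow> 0) at_top" by (rule Lim_transform_eventually)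
  have \<gamma>_bot: "(\<gamma> \<longlongrightarrow> 0) at_bot"
  proof -
    have "(\<lambda>x. \<gamma> (- x)) = \<gamma>" by (simp add: fun_eq_iff \<gamma>_def D_def)
    then have "((\<lambda>x. \<gamma> (- x)) \<longlongrightarrow> 0) at_top" using \<gamma>_top by simp
    then show ?thesis by (simp add: filterlim_at_bot_mirror)
  qed
  have near_B: "\<forall>\<^sub>F t in at_left B. \<bar>t\<bar> < B" and near_mB: "\<forall>\<^sub>F t in at_right (- B). \<bar>t\<bar> < B"
    using eventually_at_left_real[of 0 B] eventually_at_right_real[of "- B" 0] \<open>B > 0\<close>
    by (auto elim!: eventually_mono)
  have bd: "s (- B) = - 1" "s B = 1" "c (- B) = 0" "c B = 0"
    using \<open>B > 0\<close> by (auto simp: s_def c_def)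
  have cs: "continuous_on {- B..B} s"
  proof (rule continuous_on_IccI)
    show "(s \<longlongrightarrow> s (- B)) (at_right (- B))" unfolding bd
      by (rule Lim_transform_eventually[OF filterlim_compose[OF \<sigma>_bot h_bot]])
        (use near_mB in \<open>auto elim!: eventually_mono simp: s_in\<close>)
    show "(s \<longlongrightarrow> s B) (at_left B)" unfolding bd
      by (rule Lim_transform_eventually[OF filterlim_compose[OF \<sigma>_top h_top]])
        (use near_B in \<open>auto elim!: eventually_mono simp: s_in\<close>)
    show "s \<midarrow>t\<rightarrow> s t" if "- B < t" "t < B" for t
      using DERIV_isCont[OF ds[of t]] that by (auto simp: isCont_def)
  qed (use \<open>B > 0\<close> in simp)
  have cc: "continuous_on {- B..B} c"
  proof (rule continuous_on_IccI)
    show "(c \<longlongrightarrow> c (- B)) (at_right (- B))" unfolding bd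
      by (rule Lim_transform_eventually[OF filterlim_compose[OF \<gamma>_bot h_bot]])
        (use near_mB in \<open>auto elim!: eventually_mono simp: c_in\<close>)
    show "(c \<longlongrightarrow> c B) (at_left B)" unfolding bd
      by (rule Lim_transform_eventually[OF filterlim_compose[OF \<gamma>_top h_top]])
        (use near_B in \<open>auto elim!: eventually_mono simp: c_in\<close>)
    show "c \<midarrow>t\<rightarrow> c t" if "- B < t" "t < B" for t
      using DERIV_isCont[OF dc[of t]] that by (auto simp: isCont_def)
  qed (use \<open>B > 0\<close> in simp)
  have "c t \<ge> 0" for t by (simp add: c_def \<gamma>_def)
  moreover have "\<bar>s t\<bar> powr p + c t powr q = 1" for t
    using id[of "h t"] by (auto simp: s_def c_def)
  ultimately show thesis using that[OF ds dc cs cc bd] by blast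
qed

text \<open>Time is rescaled so that four quarter periods \<open>B\<close> fill the unit interval.
  The first half runs through the arc from \<open>-B\<close> to \<open>B\<close>, the second through
  the same arc with both signs reversed. As \<open>V\<close> becomes negative there, the power in
  \<open>S'\<close> has to be signed. The joint is left out of the differential equations.\<close>

lemma periodic_extremal_exists:
  fixes p q k :: real
  assumes p: "1 < p" and q: "q = p / (p - 1)" and k: "k = 4 * (pi / (p * sin (pi / p)))"
  obtains S V :: "real \<Rightarrow> real" where
    "\<And>t. t \<in> {0<..<1} - {1/2} \<Longrightarrow> (S has_real_derivative k * sgn_powr (V t) (q - 1)) (at t)"
    "\<And>t. t \<in> {0<..<1} - {1/2} \<Longrightarrow> (V has_real_derivative - k * (p - 1) * sgn_powr (S t) (p - 1)) (at t)"
    "continuous_on {0..1} S" "continuous_on {0..1} V" "S 0 = - 1" "S 1 = - 1" "S (1/2) = 1"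
    "V 0 = 0" "V 1 = 0" "\<And>t. \<bar>S t\<bar> powr p + \<bar>V t\<bar> powr q = 1"
proof -
  define B where "B = pi / (p * sin (pi / p))"
  have kB: "k = 4 * B" by (simp add: k B_def)
  have "B > 0" using p sin_pi_divide_pos[OF p] by (simp add: B_def)
  have q1: "1 < q" using p by (auto simp: q field_simps)
  obtain s c :: "real \<Rightarrow> real" where
    ds: "\<And>t. \<bar>t\<bar> < B \<Longrightarrow> (s has_real_derivative c t powr (q - 1)) (at t)" and
    dc: "\<And>t. \<bar>t\<bar> < B \<Longrightarrow> (c has_real_derivative - (p - 1) * sgn_powr (s t) (p - 1)) (at t)" and
    cs: "continuous_on {- B..B} s" and cc: "continuous_on {- B..B} c" and
    bd: "s (- B) = - 1" "s B = 1" "c (- B) = 0" "c B = 0" and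
    c0: "\<And>t. c t \<ge> 0" and id: "\<And>t. \<bar>s t\<bar> powr p + c t powr q = 1"
    using generalized_sine_cosine_exist[OF p q B_def] by blast
  define S where "S t = (if t \<le> 1/2 then s (k * t - B) else - s (k * t - 3 * B))" for t
  define V where "V t = (if t \<le> 1/2 then c (k * t - B) else - c (k * t - 3 * B))" for t
  \<comment> \<open>The condition \<open>f B = - f (- B)\<close>, satisfied by \<open>s\<close> and
    \<open>c\<close>, is what makes the two halves agree at \<open>1/2\<close>.\<close>
  have cont: "continuous_on {0..1} (\<lambda>t. if t \<le> 1/2 then f (k * t - B) else - f (k * t - 3 * B))"
    if f: "continuous_on {- B..B} f" "f B = - f (- B)" for f :: "real \<Rightarrow> real"
  proof -
    have "continuous_on ({0..1/2} \<union> {1/2..1}) (\<lambda>t. if t \<le> 1/2 then f (k * t - B) else - f (k * t - 3 * B))"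
    proof (rule continuous_on_cases)
      show "continuous_on {0..1/2} (\<lambda>t. f (k * t - B))"
        by (rule continuous_on_compose2[OF f(1)]) (use \<open>B > 0\<close> in \<open>auto intro!: continuous_intros simp: kB\<close>)
      show "continuous_on {1/2..1} (\<lambda>t. - f (k * t - 3 * B))"
        by (intro continuous_on_minus continuous_on_compose2[OF f(1)])
          (use \<open>B > 0\<close> in \<open>auto intro!: continuous_intros simp: kB\<close>)
      show "\<forall>t. t \<in> {0..1/2} \<and> \<not> t \<le> 1/2 \<or> t \<in> {1/2..1} \<and> t \<le> 1/2 \<longrightarrow> f (k * t - B) = - f (k * t - 3 * B)"
      proof (intro allI impI)
        fix t :: real
        assume "t \<in> {0..1/2} \<and> \<not> t \<le> 1/2 \<or> t \<in> {1/2..1} \<and> t \<le> 1/2"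
        then have t: "t = 1/2" by auto
        show "f (k * t - B) = - f (k * t - 3 * B)" unfolding t using f(2) by (simp add: kB)
      qed
    qed auto
    moreover have "{0..1/2} \<union> {1/2..1} = {0..1::real}" by auto
    ultimately show ?thesis by simp
  qed
  have der: "((\<lambda>t. if t \<le> 1/2 then f (k * t - B) else - f (k * t - 3 * B)) has_real_derivative
      k * (if t \<le> 1/2 then f' (k * t - B) else - f' (k * t - 3 * B))) (at t)"
    if f: "\<And>t. \<bar>t\<bar> < B \<Longrightarrow> (f has_real_derivative f' t) (at t)" and t: "t \<in> {0<..<1} - {1/2}"
    for f f' :: "real \<Rightarrow> real" and t
  proof (cases "t < 1/2")
    case True
    then have "\<bar>k * t - B\<bar> < B" using t \<open>B > 0\<close> by (auto simp: kB abs_less_iff)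
    then have "((\<lambda>t. f (k * t - B)) has_real_derivative f' (k * t - B) * k) (at t)"
      by (intro DERIV_chain2[where f = f and g = "\<lambda>t. k * t - B"] f) (auto intro!: derivative_eq_intros)
    then have "((\<lambda>t. if t \<le> 1/2 then f (k * t - B) else - f (k * t - 3 * B)) has_real_derivative f' (k * t - B) * k) (at t)"
      by (rule has_field_derivative_transform_within_open[of _ _ _ "{..<1/2}"]) (use True in auto)
    then show ?thesis using True by (simp add: mult.commute)
  next
    case False
    then have "t > 1/2" using t by auto
    then have "\<bar>k * t - 3 * B\<bar> < B" using t \<open>B > 0\<close> by (auto simp: kB abs_less_iff)
    then have "((\<lambda>t. f (k * t - 3 * B)) has_real_derivative f' (k * t - 3 * B) * k) (at t)"
      by (intro DERIV_chain2[where f = f and g = "\<lambda>t. k * t - 3 * B"] f) (auto intro!: derivative_eq_intros)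
    from DERIV_minus[OF this]
    have "((\<lambda>t. if t \<le> 1/2 then f (k * t - B) else - f (k * t - 3 * B)) has_real_derivative - (f' (k * t - 3 * B) * k)) (at t)"
      by (rule has_field_derivative_transform_within_open[of _ _ _ "{1/2<..}"]) (use \<open>t > 1/2\<close> in auto)
    then show ?thesis using \<open>t > 1/2\<close> by (simp add: mult.commute)
  qed
  show thesis
  proof
    fix t :: real assume t: "t \<in> {0<..<1} - {1/2}"
    have "(if t \<le> 1/2 then c (k * t - B) powr (q - 1) else - (c (k * t - 3 * B) powr (q - 1))) = sgn_powr (V t) (q - 1)"
      using c0[of "k * t - B"] c0[of "k * t - 3 * B"] by (auto simp: V_def sgn_powr_def sgn_if)
    then show "(S has_real_derivative k * sgn_powr (V t) (q - 1)) (at t)"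
      using der[OF ds t] unfolding S_def by simp
    have "k * (if t \<le> 1/2 then - (p - 1) * sgn_powr (s (k * t - B)) (p - 1)
        else - (- (p - 1) * sgn_powr (s (k * t - 3 * B)) (p - 1))) = k * (- (p - 1) * sgn_powr (S t) (p - 1))"
      by (auto simp: S_def sgn_powr_minus)
    also have "\<dots> = - k * (p - 1) * sgn_powr (S t) (p - 1)" by (simp add: algebra_simps)
    finally have eq: "k * (if t \<le> 1/2 then - (p - 1) * sgn_powr (s (k * t - B)) (p - 1)
        else - (- (p - 1) * sgn_powr (s (k * t - 3 * B)) (p - 1))) = - k * (p - 1) * sgn_powr (S t) (p - 1)" .
    show "(V has_real_derivative - k * (p - 1) * sgn_powr (S t) (p - 1)) (at t)"
      unfolding V_def using der[of c "\<lambda>t. - (p - 1) * sgn_powr (s t) (p - 1)", OF dc t]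
      unfolding eq by simp
  next
    show "continuous_on {0..1} S" "continuous_on {0..1} V"
      unfolding S_def V_def using cont[OF cs] cont[OF cc] bd by auto
    show "S 0 = - 1" "S 1 = - 1" "S (1/2) = 1" "V 0 = 0" "V 1 = 0"
      using bd by (simp_all add: S_def V_def kB)
    show "\<bar>S t\<bar> powr p + \<bar>V t\<bar> powr q = 1" for t
      using id[of "k * t - B"] id[of "k * t - 3 * B"] c0[of "k * t - B"] c0[of "k * t - 3 * B"]
      by (auto simp: S_def V_def)
  qed
qed

subsection \<open>The isoperimetric inequality\<close>

text \<open>
  The bracket is the value of \<open>(|w|\<^sup>q \<psi>)'\<close> for \<open>w' = b\<close>, \<open>\<psi> = s\<close> and \<open>\<psi>\<close> solving the Riccati equation
  \<open>\<psi>' = - \<mu> - (q - 1) |\<psi>|\<^sup>p\<close>. Both halves are instances of Young's inequality.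
\<close>
lemma calibration_inequality:
  fixes p q :: real
  assumes p: "1 < p" and q: "q = p / (p - 1)" and "\<mu> > 0" "C > 0" and C: "C * \<mu> powr (1/q) = 2"
  shows "2 * a * w \<le> C * (\<bar>a\<bar> powr p / p + \<bar>b\<bar> powr q / q) -
    C / q * (q * sgn_powr w (q - 1) * b * s - \<bar>w\<bar> powr q * (\<mu> + (q - 1) * \<bar>s\<bar> powr p))"
proof -
  have q1: "1 < q" and p': "p = q / (q - 1)" and qp: "q / p = q - 1" and pq: "(q - 1) * p = q"
    using p by (auto simp: q field_simps)
  \<comment> \<open>The hypothesis on \<open>C\<close> moves the weight
    \<open>\<mu> powr (1/q)\<close> onto \<open>w\<close>; the resulting
    \<open>\<mu> * |w|^q\<close> is exactly the \<open>\<mu>\<close> term of the bracket. What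
    remains is Young's inequality for \<open>b\<close>.\<close>
  have "2 * a * w = C * (a * (\<mu> powr (1/q) * w))" using C by (simp add: algebra_simps)
  also have "\<dots> \<le> C * (\<bar>a\<bar> powr p / p + \<bar>\<mu> powr (1/q) * w\<bar> powr q / q)"
    using \<open>C > 0\<close> by (intro mult_left_mono Young_powr[OF p q]) auto
  also have "\<bar>\<mu> powr (1/q) * w\<bar> powr q = \<mu> * \<bar>w\<bar> powr q"
    using \<open>\<mu> > 0\<close> q1 by (simp add: abs_mult powr_mult powr_powr)
  finally have 1: "2 * a * w \<le> C * (\<bar>a\<bar> powr p / p + \<mu> * \<bar>w\<bar> powr q / q)" .
  \<comment> \<open>Now the exponents are interchanged: \<open>b\<close> carries \<open>q\<close>,
    and \<open>(q - 1) * p = q\<close> turns the p-th power of the other factor into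
    \<open>|w|^q * |s|^p\<close>.\<close>
  have "b * (sgn_powr w (q - 1) * s) \<le> \<bar>b\<bar> powr q / q + \<bar>sgn_powr w (q - 1) * s\<bar> powr p / p"
    by (rule Young_powr[OF q1 p'])
  also have "\<bar>sgn_powr w (q - 1) * s\<bar> powr p = \<bar>w\<bar> powr q * \<bar>s\<bar> powr p"
    by (simp add: abs_mult powr_mult powr_powr pq)
  finally have "C / q * (q * (b * (sgn_powr w (q - 1) * s))) \<le> C / q * (q * (\<bar>b\<bar> powr q / q + \<bar>w\<bar> powr q * \<bar>s\<bar> powr p / p))"
    using \<open>C > 0\<close> q1 by (intro mult_left_mono) auto
  also have "q * (\<bar>b\<bar> powr q / q + \<bar>w\<bar> powr q * \<bar>s\<bar> powr p / p) = \<bar>b\<bar> powr q + (q - 1) * (\<bar>w\<bar> powr q * \<bar>s\<bar> powr p)"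
    using q1 by (simp add: distrib_left flip: qp)
  finally have 2: "C / q * (q * (b * (sgn_powr w (q - 1) * s))) \<le> C / q * (\<bar>b\<bar> powr q + (q - 1) * (\<bar>w\<bar> powr q * \<bar>s\<bar> powr p))" .
  show ?thesis using 1 2 by (simp add: algebra_simps diff_divide_distrib add_divide_distrib)
qed

text \<open>The pointwise inequality integrated over an interval free of poles of
  \<open>\<psi>\<close>. \<open>\<Theta>\<close> absorbs the integration by parts as well as
  \<open>|u2 - c|^q * \<psi>\<close>, so that only its boundary values survive and adjacent
  intervals can be chained.\<close>

lemma calibrated_estimate:
  fixes p q k m c B a b I J :: real and h u1 u2 u1' u2' \<psi> \<Theta> :: "real \<Rightarrow> real"
  assumes p: "1 < p" and q: "q = p / (p - 1)" and "k > 0"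
    and h: "\<And>t. \<bar>t\<bar> < B \<Longrightarrow> (h has_real_derivative 1 + \<bar>h t\<bar> powr p) (at t)"
    and "a \<le> b" and ab: "\<And>t. t \<in> {a..b} \<Longrightarrow> \<bar>k * (t - m)\<bar> < B"
    and ac1: "absolutely_continuous_on {a..b} u1" and ac2: "absolutely_continuous_on {a..b} u2"
    and N: "negligible N"
    and d1: "\<And>t. t \<in> {a..b} - N \<Longrightarrow> (u1 has_real_derivative u1' t) (at t within {a..b})"
    and d2: "\<And>t. t \<in> {a..b} - N \<Longrightarrow> (u2 has_real_derivative u2' t) (at t within {a..b})"
    and I: "((\<lambda>t. u2' t * u1 t - u1' t * u2 t) has_integral I) {a..b}"
    and J: "((\<lambda>t. \<bar>u1' t\<bar> powr p / p + \<bar>u2' t\<bar> powr q / q) has_integral J) {a..b}"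
    and C: "C = 2 / (k * (p - 1) powr (1/p))"
    and \<psi>: "\<psi> = (\<lambda>t. - ((k * (p - 1)) powr (q - 1)) * h (k * (t - m)))"
    and \<Theta>: "\<Theta> = (\<lambda>t. - u1 t * u2 t + 2 * c * u1 t - C / q * (\<bar>u2 t - c\<bar> powr q * \<psi> t))"
  shows "- I \<le> C * J + (\<Theta> b - \<Theta> a)"
proof -
  have q1: "1 < q" and pq: "(q - 1) * (p - 1) = 1" and q1p: "(q - 1) / q = 1 / p"
    using p by (auto simp: q field_simps)
  \<comment> \<open>The Riccati equation for \<open>- A * h (k * (t - m))\<close> needs
    \<open>k * A = (q - 1) * A powr p\<close> as coefficient of \<open>|h|^p\<close>, that is
    \<open>A powr (p - 1) = k * (p - 1)\<close>. The constant term is then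
    \<open>\<mu> = k * A\<close>.\<close>
  define A where "A = (k * (p - 1)) powr (q - 1)"
  define \<mu> where "\<mu> = k * A"
  have Apos: "A > 0" and lpos: "\<mu> > 0" and Cpos: "C > 0"
    using p \<open>k > 0\<close> by (auto simp: A_def \<mu>_def C)
  have "\<mu> = k powr 1 * k powr (q - 1) * (p - 1) powr (q - 1)"
    using p \<open>k > 0\<close> by (simp add: \<mu>_def A_def powr_mult)
  also have "k powr 1 * k powr (q - 1) = k powr q" by (subst powr_add[symmetric]) simp
  finally have "\<mu> powr (1/q) = k * (p - 1) powr ((q - 1) / q)"
    using p q1 \<open>k > 0\<close> by (simp add: powr_mult powr_powr)
  then have C\<mu>: "C * \<mu> powr (1/q) = 2"
    using p \<open>k > 0\<close> by (simp add: C q1p)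
  have "A powr (p - 1) = k * (p - 1)"
    using p \<open>k > 0\<close> by (simp add: A_def powr_powr pq)
  then have Ap: "A powr p = A * (k * (p - 1))"
    using Apos by (simp add: powr_diff field_simps)
  have \<psi>': "(\<psi> has_real_derivative - (\<mu> + (q - 1) * \<bar>\<psi> t\<bar> powr p)) (at t)" if t: "t \<in> {a..b}" for t
  proof -
    have "((\<lambda>t. h (k * (t - m))) has_real_derivative (1 + \<bar>h (k * (t - m))\<bar> powr p) * k) (at t)"
      by (rule DERIV_chain2[where f = h and g = "\<lambda>t. k * (t - m)", OF h[OF ab[OF t]]]) (auto intro!: derivative_eq_intros)
    then have "(\<psi> has_real_derivative - A * ((1 + \<bar>h (k * (t - m))\<bar> powr p) * k)) (at t)"
      unfolding \<psi> A_def[symmetric] by (rule DERIV_cmult)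
    also have "\<bar>\<psi> t\<bar> powr p = A * (k * (p - 1)) * \<bar>h (k * (t - m))\<bar> powr p"
      using Apos Ap unfolding \<psi> A_def[symmetric] by (simp add: abs_mult powr_mult)
    then have "- A * ((1 + \<bar>h (k * (t - m))\<bar> powr p) * k) = - (\<mu> + (q - 1) * \<bar>\<psi> t\<bar> powr p)"
      using pq by (simp add: \<mu>_def) algebra
    finally show ?thesis .
  qed
  have cont_\<psi>: "continuous_on {a..b} \<psi>"
    using \<psi>' DERIV_isCont by (blast intro: continuous_at_imp_continuous_on)
  have ac_\<psi>: "absolutely_continuous_on {a..b} \<psi>"
  proof (rule C1_imp_absolutely_continuous_on)
    show "(\<psi> has_real_derivative - (\<mu> + (q - 1) * \<bar>\<psi> t\<bar> powr p)) (at t within {a..b})"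
      if "t \<in> {a..b}" for t
      using \<psi>'[OF that] by (rule has_field_derivative_at_within)
    show "continuous_on {a..b} (\<lambda>t. - (\<mu> + (q - 1) * \<bar>\<psi> t\<bar> powr p))"
      using p by (intro continuous_intros continuous_on_powr' cont_\<psi>) auto
  qed
  have ac_w: "absolutely_continuous_on {a..b} (\<lambda>t. \<bar>u2 t - c\<bar> powr q)"
  proof (rule absolutely_continuous_on_compose_C1[OF ac2])
    show "((\<lambda>x. \<bar>x - c\<bar> powr q) has_real_derivative q * sgn_powr (x - c) (q - 1)) (at x)" for x
    proof -
      have "((\<lambda>x. x - c) has_real_derivative 1) (at x)" by (auto intro!: derivative_eq_intros)
      from DERIV_chain2[OF DERIV_abs_powr[OF q1] this] show ?thesis by simp
    qed
    show "continuous_on UNIV (\<lambda>x. q * sgn_powr (x - c) (q - 1))"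
      using q1 by (intro continuous_intros) auto
  qed
  have ac_\<Theta>: "absolutely_continuous_on {a..b} \<Theta>"
  proof -
    have "absolutely_continuous_on {a..b} (\<lambda>t. ((- 1) * (u1 t * u2 t) + 2 * c * u1 t)
      + (- (C / q)) * (\<bar>u2 t - c\<bar> powr q * \<psi> t))"
      by (intro absolutely_continuous_on_add absolutely_continuous_on_cmult
          absolutely_continuous_on_mult ac1 ac2 ac_\<psi> ac_w)
    then show ?thesis by (simp add: \<Theta>)
  qed
  define \<Theta>' where "\<Theta>' t = - (u1' t * u2 t + u1 t * u2' t) + 2 * c * u1' t -
    C / q * (q * sgn_powr (u2 t - c) (q - 1) * u2' t * \<psi> t
      - \<bar>u2 t - c\<bar> powr q * (\<mu> + (q - 1) * \<bar>\<psi> t\<bar> powr p))" for t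
  have "(\<Theta>' has_integral (\<Theta> b - \<Theta> a)) {a..b}"
  proof (rule absolutely_continuous_on_has_integral[OF \<open>a \<le> b\<close> ac_\<Theta> N])
    fix t assume t: "t \<in> {a..b} - N"
    have w: "((\<lambda>t. \<bar>u2 t - c\<bar> powr q) has_real_derivative q * sgn_powr (u2 t - c) (q - 1) * u2' t)
      (at t within {a..b})"
    proof -
      have "((\<lambda>t. u2 t - c) has_real_derivative u2' t) (at t within {a..b})"
        using d2[OF t] by (auto intro!: derivative_eq_intros)
      from DERIV_chain2[OF DERIV_abs_powr[OF q1] this] show ?thesis by simp
    qed
    have \<psi>'': "(\<psi> has_real_derivative - (\<mu> + (q - 1) * \<bar>\<psi> t\<bar> powr p)) (at t within {a..b})"
      using \<psi>' t by (blast intro: has_field_derivative_at_within)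
    define X where "X t = \<bar>u2 t - c\<bar> powr q * \<psi> t" for t
    have "(X has_real_derivative q * sgn_powr (u2 t - c) (q - 1) * u2' t * \<psi> t
        - \<bar>u2 t - c\<bar> powr q * (\<mu> + (q - 1) * \<bar>\<psi> t\<bar> powr p)) (at t within {a..b})"
      unfolding X_def by (rule DERIV_cong[OF DERIV_mult[OF w \<psi>'']]) (simp add: algebra_simps)
    then have "(\<Theta> has_real_derivative \<Theta>' t) (at t within {a..b})"
      unfolding \<Theta> \<Theta>'_def X_def[symmetric] using q1
      by (auto intro!: derivative_eq_intros d1[OF t] d2[OF t])
    then show "(\<Theta> has_vector_derivative \<Theta>' t) (at t within {a..b})"
      by (simp add: has_real_derivative_iff_has_vector_derivative)
  qed
  then have "((\<lambda>t. C * (\<bar>u1' t\<bar> powr p / p + \<bar>u2' t\<bar> powr q / q) + \<Theta>' t) has_integral C * J + (\<Theta> b - \<Theta> a)) {a..b}"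
    using J by (intro has_integral_add has_integral_mult_right)
  moreover have "((\<lambda>t. - (u2' t * u1 t - u1' t * u2 t)) has_integral - I) {a..b}"
    using I by (rule has_integral_neg)
  \<comment> \<open>Integration by parts in pointwise form:
    \<open>u1' u2 - u1 u2' = 2 u1' (u2 - c) - (u1 u2)' + 2 c u1'\<close>.\<close>
  moreover have "- (u2' t * u1 t - u1' t * u2 t) \<le> C * (\<bar>u1' t\<bar> powr p / p + \<bar>u2' t\<bar> powr q / q) + \<Theta>' t" for t
    using calibration_inequality[OF p q lpos Cpos C\<mu>, of "u1' t" "u2 t - c" "u2' t" "\<psi> t"]
    unfolding \<Theta>'_def by (simp add: algebra_simps)
  ultimately show ?thesis by (blast intro: has_integral_le)
qed

text \<open>By periodicity the difference \<open>v (t + 1/2) - v t\<close> takes opposite values at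
  0 and \<open>1/2\<close>, so it has a zero in between.\<close>

lemma periodic_half_period_coincidence:
  fixes v :: "real \<Rightarrow> real"
  assumes "continuous_on {0..1} v" "v 0 = v 1"
  obtains t where "t \<in> {0..1/2}" "v (t + 1/2) = v t"
proof -
  define g where "g t = v (t + 1/2) - v t" for t
  have "continuous_on {0..1/2} g"
    unfolding g_def by (intro continuous_intros continuous_on_compose2[OF assms(1)]
      continuous_on_subset[OF assms(1)]) auto
  moreover have "g (1/2) = - g 0" using assms by (simp add: g_def)
  ultimately have "\<exists>t\<ge>0. t \<le> 1/2 \<and> g t = 0"
    using IVT'[of g 0 0 "1/2"] IVT2'[of g "1/2" 0 0] by (cases "g 0 \<le> 0") auto
  then show thesis using that by (auto simp: g_def)
qed

text \<open>The cuts \<open>t0\<close> and \<open>t0 + 1/2\<close> leave a middle interval of length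
  \<open>1/2\<close> and two outer pieces, which together form the other half period modulo 1. Each
  piece is calibrated separately, and the boundary terms cancel around the circle.\<close>

lemma periodic_isoperimetric_inequality:
  fixes p q I J :: real and u1 u2 u1' u2' :: "real \<Rightarrow> real"
  assumes p: "1 < p" and q: "q = p / (p - 1)"
    and ac1: "absolutely_continuous_on {0..1} u1" and ac2: "absolutely_continuous_on {0..1} u2"
    and N: "negligible N"
    and d1: "\<And>t. t \<in> {0..1} - N \<Longrightarrow> (u1 has_real_derivative u1' t) (at t)"
    and d2: "\<And>t. t \<in> {0..1} - N \<Longrightarrow> (u2 has_real_derivative u2' t) (at t)"
    and per: "u1 0 = u1 1" "u2 0 = u2 1"
    and I: "((\<lambda>t. u2' t * u1 t - u1' t * u2 t) has_integral I) {0..1}"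
    and J: "((\<lambda>t. \<bar>u1' t\<bar> powr p / p + \<bar>u2' t\<bar> powr q / q) has_integral J) {0..1}"
  shows "- I \<le> p * sin (pi / p) / (2 * pi * (p - 1) powr (1 / p)) * J"
proof -
  define B where "B = pi / (p * sin (pi / p))"
  have sin: "sin (pi / p) > 0" using p by (rule sin_pi_divide_pos)
  then have "B > 0" using p by (simp add: B_def)
  obtain h where h: "\<And>t. \<bar>t\<bar> < B \<Longrightarrow> (h has_real_derivative 1 + \<bar>h t\<bar> powr p) (at t)"
    using generalized_tan_exists[OF p B_def] by blast
  obtain t0 where t0: "t0 \<in> {0..1/2}" "u2 (t0 + 1/2) = u2 t0"
    using periodic_half_period_coincidence[OF absolutely_continuous_on_imp_continuous_on[OF ac2] per(2)]
    by blast
  define c where "c = u2 t0"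
  define f where "f t = u2' t * u1 t - u1' t * u2 t" for t
  define g where "g t = \<bar>u1' t\<bar> powr p / p + \<bar>u2' t\<bar> powr q / q" for t
  have fi: "f integrable_on {0..1}" and fI: "integral {0..1} f = I"
    and gi: "g integrable_on {0..1}" and gJ: "integral {0..1} g = J"
    using I J unfolding f_def[symmetric] g_def[symmetric] by (auto simp: has_integral_iff)
  \<comment> \<open>\<open>k < 4 B\<close> keeps \<open>\<psi>\<close> finite on closed intervals of length \<open>1/2\<close>; the jumps of \<open>\<psi>\<close> at \<open>t0\<close> and
    \<open>t0 + 1/2\<close> are harmless because the factor \<open>|u2 - c|\<^sup>q\<close> vanishes there.\<close>
  have step: "- I * k \<le> 2 / (p - 1) powr (1/p) * J" if k: "0 < k" "k < 4 * B" for k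
  proof -
    define C where "C = 2 / (k * (p - 1) powr (1/p))"
    define \<psi> where "\<psi> m = (\<lambda>t. - ((k * (p - 1)) powr (q - 1)) * h (k * (t - m)))" for m
    define \<Theta> where "\<Theta> m = (\<lambda>t. - u1 t * u2 t + 2 * c * u1 t - C / q * (\<bar>u2 t - c\<bar> powr q * \<psi> m t))" for m
    have est: "- integral {a..b} f \<le> C * integral {a..b} g + (\<Theta> m b - \<Theta> m a)"
      if ab: "a \<le> b" "{a..b} \<subseteq> {0..1}" "{a..b} \<subseteq> {m-1/4..m+1/4}" for a b m
    proof (rule calibrated_estimate[OF p q k(1) h ab(1) _ _ _ N _ _ _ _ C_def \<psi>_def \<Theta>_def])
      fix t assume "t \<in> {a..b}"
      then have "m - 1/4 \<le> t" "t \<le> m + 1/4" using ab(3) by (meson atLeastAtMost_iff subsetD)+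
      then have "\<bar>t - m\<bar> \<le> 1/4" by linarith
      then have "k * \<bar>t - m\<bar> \<le> k * (1/4)" using k by (intro mult_left_mono) auto
      moreover have "\<bar>k * (t - m)\<bar> = k * \<bar>t - m\<bar>" using k by (simp add: abs_mult)
      ultimately show "\<bar>k * (t - m)\<bar> < B" using k by linarith
    next
      fix t assume "t \<in> {a..b} - N"
      then show "(u1 has_real_derivative u1' t) (at t within {a..b})"
        "(u2 has_real_derivative u2' t) (at t within {a..b})"
        using d1 d2 ab(2) by (auto intro: has_field_derivative_at_within)
    next
      show "((\<lambda>t. u2' t * u1 t - u1' t * u2 t) has_integral integral {a..b} f) {a..b}"
        "((\<lambda>t. \<bar>u1' t\<bar> powr p / p + \<bar>u2' t\<bar> powr q / q) has_integral integral {a..b} g) {a..b}"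
        unfolding f_def[symmetric] g_def[symmetric]
        using integrable_on_subinterval[OF fi ab(2)] integrable_on_subinterval[OF gi ab(2)]
        by (auto intro: integrable_integral)
    qed (use ac1 ac2 ab(2) absolutely_continuous_on_subset in blast)+
    have split: "integral {0..1} F = integral {0..t0} F + integral {t0..t0+1/2} F + integral {t0+1/2..1} F"
      if "F integrable_on {0..1}" for F :: "real \<Rightarrow> real"
    proof -
      have "integral {0..t0} F + integral {t0..1} F = integral {0..1} F"
        using t0 that by (intro Henstock_Kurzweil_Integration.integral_combine) auto
      moreover have "F integrable_on {t0..1}"
        using that t0 by (auto intro: integrable_on_subinterval)
      then have "integral {t0..t0+1/2} F + integral {t0+1/2..1} F = integral {t0..1} F"
        using t0 by (intro Henstock_Kurzweil_Integration.integral_combine) auto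
      ultimately show ?thesis by simp
    qed
    \<comment> \<open>The three centres are the midpoints of the half periods that contain the
      pieces; the first and the last differ by the full period 1.\<close>
    have "- I \<le> C * J + (\<Theta> (t0 - 1/4) t0 - \<Theta> (t0 - 1/4) 0) + (\<Theta> (t0 + 1/4) (t0 + 1/2) - \<Theta> (t0 + 1/4) t0)
      + (\<Theta> (t0 + 3/4) 1 - \<Theta> (t0 + 3/4) (t0 + 1/2))"
      using est[of 0 t0 "t0-1/4"] est[of t0 "t0+1/2" "t0+1/4"] est[of "t0+1/2" 1 "t0+3/4"] t0
        split[OF fi] split[OF gi] fI gJ
      by (auto simp: distrib_left)
    also have "\<dots> = C * J"
    proof -
      have "q > 0" using p by (simp add: q)
      \<comment> \<open>At both cuts \<open>u2\<close> equals \<open>c\<close>, so the factor of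
        \<open>\<psi>\<close> vanishes and the choice of centre does not matter.\<close>
      then have "\<Theta> m t0 = \<Theta> m' t0" "\<Theta> m (t0 + 1/2) = \<Theta> m' (t0 + 1/2)" for m m'
        using t0 by (simp_all add: \<Theta>_def c_def)
      \<comment> \<open>The points 0 and 1 lie at the same offset from their centres, so periodicity
        of the curve closes the chain.\<close>
      moreover have "\<psi> (t0 - 1/4) 0 = \<psi> (t0 + 3/4) 1" by (simp add: \<psi>_def algebra_simps)
      then have "\<Theta> (t0 - 1/4) 0 = \<Theta> (t0 + 3/4) 1" using per by (simp add: \<Theta>_def)
      ultimately show ?thesis by (smt (verit))
    qed
    finally have "- I * k \<le> C * J * k" using k by (intro mult_right_mono) auto
    then show ?thesis using k by (simp add: C_def)
  qed
  \<comment> \<open>\<open>C\<close> depends on \<open>k\<close> only through \<open>1 / k\<close>.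
    After multiplication by \<open>k\<close> the right side is constant and the left side linear, so
    \<open>k\<close> may tend to \<open>4 B\<close>.\<close>
  have "- I * (4 * B) \<le> 2 / (p - 1) powr (1/p) * J"
  proof (rule tendsto_upperbound)
    show "((\<lambda>k. - I * k) \<longlongrightarrow> - I * (4 * B)) (at_left (4 * B))"
      by (intro tendsto_intros)
    show "\<forall>\<^sub>F k in at_left (4 * B). - I * k \<le> 2 / (p - 1) powr (1/p) * J"
    proof -
      have "\<forall>\<^sub>F k in at_left (4 * B). k \<in> {0<..<4 * B}"
        using eventually_at_left_real[of 0 "4 * B"] \<open>B > 0\<close> by simp
      then show ?thesis by eventually_elim (rule step, auto)
    qed
  qed simp
  then have "- I \<le> 2 / (p - 1) powr (1/p) * J / (4 * B)"
    using pos_le_divide_eq[of "4 * B"] \<open>B > 0\<close> by (metis mult_pos_pos zero_less_numeral)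
  also have "\<dots> = p * sin (pi / p) / (2 * pi * (p - 1) powr (1 / p)) * J"
    using p sin by (simp add: B_def field_simps)
  finally show ?thesis .
qed

subsection \<open>The quotient on the Sobolev--Orlicz space\<close>

text \<open>For continuous \<open>f\<close> finitely many exceptional points do not disturb the
  fundamental theorem, so increments are integrals of the bounded \<open>f'\<close>. This gives the
  absolute continuity of the extremal curve in spite of its joint.\<close>

lemma piecewise_C1_imp_lipschitz_on:
  fixes f :: "real \<Rightarrow> 'a::banach"
  assumes "finite K" and f: "continuous_on {a..b} f"
    and f': "\<And>x. x \<in> {a<..<b} - K \<Longrightarrow> (f has_vector_derivative f' x) (at x)"
    and M: "\<And>x. x \<in> {a..b} \<Longrightarrow> norm (f' x) \<le> M" "0 \<le> M"
  shows "M-lipschitz_on {a..b} f"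
proof (rule lipschitz_onI)
  have *: "dist (f x) (f y) \<le> M * dist x y" if "x \<in> {a..b}" "y \<in> {a..b}" "x \<le> y" for x y
  proof -
    have "(f' has_integral (f y - f x)) {x..y}"
      by (rule fundamental_theorem_of_calculus_interior_strong[OF \<open>finite K\<close> \<open>x \<le> y\<close>])
        (use that f f' in \<open>auto intro: continuous_on_subset\<close>)
    then have "norm (f y - f x) \<le> M * Henstock_Kurzweil_Integration.content (cbox x y)"
      by (intro has_integral_bound[of M f']) (use M that in auto)
    then show ?thesis using that by (simp add: dist_norm norm_minus_commute)
  qed
  show "dist (f x) (f y) \<le> M * dist x y" if "x \<in> {a..b}" "y \<in> {a..b}" for x y
    using *[of x y] *[of y x] that by (cases "x \<le> y") (auto simp: dist_commute)
qed fact

text \<open>Includes \<open>J = 0\<close>: the hypothesis then says \<open>0 \<le> r\<close>, and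
  since the \<open>ereal\<close> inverse of 0 is \<infinity>, the quotient is 0 or
  \<infinity>.\<close>

lemma ereal_neg_le_divide:
  assumes "0 \<le> K" "0 \<le> J" "- K * J \<le> r"
  shows "- ereal K \<le> ereal r / ereal J"
proof (cases "J = 0")
  case True
  then have "r \<ge> 0" using assms by simp
  then have "0 \<le> ereal r / ereal J" using True by (auto simp: divide_ereal_def intro!: ereal_0_le_mult)
  moreover have "- ereal K \<le> 0" using assms by simp
  ultimately show ?thesis by (rule order_trans[rotated])
next
  case False
  then have "J > 0" using assms by simp
  then have "- K \<le> r / J" using assms by (simp add: pos_le_divide_eq)
  then show ?thesis using False by simp
qed

lemma Sobolev_Orlicz_quotient_ge:
  fixes p q :: real
  assumes p: "1 < p" and q: "q = p / (p - 1)"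
    and G: "G = (\<lambda>(u1, u2). \<bar>u1\<bar> powr p / p + \<bar>u2\<bar> powr q / q)"
    and u: "u \<in> Sobolev_Orlicz_periodic G"
  shows "- ereal (p * sin (pi / p) / (2 * pi * (p - 1) powr (1 / p))) \<le>
    ereal (LINT t|lebesgue_on {0..1}. Jmap (vector_derivative u (at t)) \<bullet> u t) /
         enn2ereal (\<integral>\<^sup>+t. ennreal (G (vector_derivative u (at t))) \<partial>lebesgue_on {0..1})"
    (is "- ereal ?K \<le> ereal ?num / enn2ereal ?den")
proof -
  have q1: "1 < q" using p by (auto simp: q field_simps)
  have K: "0 \<le> ?K" using p sin_pi_divide_pos[OF p] by simp
  define d where "d t = vector_derivative u (at t)" for t
  have G0: "G x \<ge> 0" for x using p q1 by (auto simp: G split: prod.split)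
  have contG: "continuous_on UNIV G"
    unfolding G case_prod_unfold using p q1 by (intro continuous_intros continuous_on_powr') auto
  have ac: "absolutely_continuous_on {0..1} u" and dm: "d \<in> borel_measurable (lebesgue_on {0..1})"
    and per: "u 0 = u 1" and ae: "AE t in lebesgue_on {0..1}. u differentiable (at t)"
    using u by (auto simp: Sobolev_Orlicz_periodic_def Orlicz_def d_def[symmetric])
  have Gm: "(\<lambda>t. G (d t)) \<in> borel_measurable (lebesgue_on {0..1})"
    using measurable_compose[OF dm borel_measurable_continuous_onI[OF contG]] .
  define N where "N = {t \<in> {0..1}. \<not> u differentiable (at t)}"
  have "AE t in lebesgue. t \<in> {0..1} \<longrightarrow> u differentiable (at t)"
    using ae by (subst (asm) AE_restrict_space_iff) auto
  then obtain N' where "{t \<in> space lebesgue. \<not> (t \<in> {0..1} \<longrightarrow> u differentiable (at t))} \<subseteq> N'"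
    "emeasure lebesgue N' = 0" "N' \<in> sets lebesgue"
    by (rule AE_E)
  then have "N \<subseteq> N'" "negligible N'"
    by (auto simp: N_def negligible_iff_null_sets null_sets_def)
  then have N: "negligible N" using negligible_subset by blast
  have der: "(u has_vector_derivative d t) (at t)" if "t \<in> {0..1} - N" for t
    using that by (auto simp: N_def d_def vector_derivative_works)
  have d1: "((\<lambda>t. fst (u t)) has_real_derivative fst (d t)) (at t)" if "t \<in> {0..1} - N" for t
    using bounded_linear.has_vector_derivative[OF bounded_linear_fst der[OF that]]
    by (simp add: has_real_derivative_iff_has_vector_derivative)
  have d2: "((\<lambda>t. snd (u t)) has_real_derivative snd (d t)) (at t)" if "t \<in> {0..1} - N" for t
    using bounded_linear.has_vector_derivative[OF bounded_linear_snd der[OF that]]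
    by (simp add: has_real_derivative_iff_has_vector_derivative)
  show ?thesis
  proof (cases "?den = \<infinity>")
    \<comment> \<open>A real number divided by \<infinity> is 0, which lies above the nonpositive
      bound.\<close>
    case True
    then show ?thesis using K by simp
  next
    case False
    then have fin: "(\<integral>\<^sup>+t. ennreal (G (d t)) \<partial>lebesgue_on {0..1}) < \<infinity>"
      by (simp add: d_def less_top)
    have Gi: "integrable (lebesgue_on {0..1}) (\<lambda>t. G (d t))"
      by (rule integrableI_nonneg[OF Gm _ fin]) (simp add: G0)
    define J where "J = (LINT t|lebesgue_on {0..1}. G (d t))"
    have den: "?den = ennreal J"
      unfolding J_def d_def[symmetric] by (rule nn_integral_eq_integral[OF Gi]) (simp add: G0)
    have J0: "J \<ge> 0" unfolding J_def by (rule integral_nonneg_AE) (simp add: G0)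
    have J: "((\<lambda>t. \<bar>fst (d t)\<bar> powr p / p + \<bar>snd (d t)\<bar> powr q / q) has_integral J) {0..1}"
      using has_integral_integral_lebesgue_on[OF Gi] by (simp add: J_def G case_prod_unfold)
    have "- ?K * J \<le> ?num"
    proof (cases "integrable (lebesgue_on {0..1}) (\<lambda>t. Jmap (d t) \<bullet> u t)")
      case True
      have "((\<lambda>t. snd (d t) * fst (u t) - fst (d t) * snd (u t)) has_integral ?num) {0..1}"
        using has_integral_integral_lebesgue_on[OF True]
        by (simp add: d_def[symmetric] Jmap_def case_prod_unfold inner_prod_def)
      from periodic_isoperimetric_inequality[OF p q absolutely_continuous_on_fst[OF ac]
        absolutely_continuous_on_snd[OF ac] N d1 d2 _ _ this J] per
      show ?thesis by simp
    next
      case False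
      \<comment> \<open>The Bochner integral of a non-integrable function is \<open>0\<close>.\<close>
      then have "?num = 0" unfolding d_def by (rule not_integrable_integral_eq)
      then show ?thesis using mult_nonneg_nonneg[OF K J0] by simp
    qed
    with K J0 show ?thesis unfolding den by (simp only: enn2ereal_ennreal ereal_neg_le_divide)
  qed
qed

section \<open>The extremal curve\<close>

lemma Sobolev_Orlicz_quotient_attained:
  fixes p q :: real
  assumes p: "1 < p" and q: "q = p / (p - 1)"
    and G: "G = (\<lambda>(u1, u2). \<bar>u1\<bar> powr p / p + \<bar>u2\<bar> powr q / q)"
  obtains u where "u \<in> Sobolev_Orlicz_periodic G" "\<not> u constant_on {0..1}"
    "ereal (LINT t|lebesgue_on {0..1}. Jmap (vector_derivative u (at t)) \<bullet> u t) /
         enn2ereal (\<integral>\<^sup>+t. ennreal (G (vector_derivative u (at t))) \<partial>lebesgue_on {0..1}) =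
     - ereal (p * sin (pi / p) / (2 * pi * (p - 1) powr (1 / p)))"
proof -
  have q1: "1 < q" and qinv: "1 / q = (p - 1) / p" and q1p: "(q - 1) / q = 1 / p"
    using p by (auto simp: q field_simps)
  have pq: "(q - 1) * p = q" "(p - 1) * q = p" using p by (auto simp: q field_simps)
  have sin: "sin (pi / p) > 0" using sin_pi_divide_pos[OF p] .
  have G0: "G x \<ge> 0" for x using p q1 by (auto simp: G split: prod.split)
  have contG: "continuous_on UNIV G"
    unfolding G case_prod_unfold using p q1 by (intro continuous_intros continuous_on_powr') auto
  define k where "k = 4 * (pi / (p * sin (pi / p)))"
  have k: "k > 0" using p sin by (simp add: k_def)
  obtain S V :: "real \<Rightarrow> real" where
    dS: "\<And>t. t \<in> {0<..<1} - {1/2} \<Longrightarrow> (S has_real_derivative k * sgn_powr (V t) (q - 1)) (at t)" and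
    dV: "\<And>t. t \<in> {0<..<1} - {1/2} \<Longrightarrow> (V has_real_derivative - k * (p - 1) * sgn_powr (S t) (p - 1)) (at t)" and
    cont: "continuous_on {0..1} S" "continuous_on {0..1} V" and
    bd: "S 0 = - 1" "S 1 = - 1" "S (1/2) = 1" "V 0 = 0" "V 1 = 0" and
    id: "\<And>t. \<bar>S t\<bar> powr p + \<bar>V t\<bar> powr q = 1"
    using periodic_extremal_exists[OF p q k_def] by blast
  \<comment> \<open>\<open>\<mu>\<close> is the Riccati constant at the limiting value
    \<open>k = 4 B\<close>. Equality in Young's inequality for \<open>u1'\<close> and
    \<open>\<mu> powr (1/q) * u2\<close> means \<open>|u1'|^p = \<mu> * |u2|^q\<close>; as
    \<open>(q - 1) * p = q\<close>, this reads \<open>(\<alpha> * k) powr p = \<mu>\<close> and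
    fixes \<open>\<alpha>\<close>.\<close>
  define \<mu> where "\<mu> = k powr q * (p - 1) powr (q - 1)"
  define \<alpha> where "\<alpha> = \<mu> powr (1/p) / k"
  have mu: "\<mu> > 0" and alpha: "\<alpha> > 0" using p k by (auto simp: \<mu>_def \<alpha>_def)
  have ak: "(\<alpha> * k) powr p = \<mu>" using p k mu by (simp add: \<alpha>_def powr_powr)
  define u where "u t = (\<alpha> * S t, V t)" for t
  define d where "d t = (\<alpha> * (k * sgn_powr (V t) (q - 1)), - k * (p - 1) * sgn_powr (S t) (p - 1))" for t
  have du: "(u has_vector_derivative d t) (at t)" if "t \<in> {0<..<1} - {1/2}" for t
    unfolding u_def d_def using dS[OF that] dV[OF that]
    by (intro has_vector_derivative_Pair has_vector_derivative_mult_right)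
       (auto simp: has_real_derivative_iff_has_vector_derivative)
  have cu: "continuous_on {0..1} u" and cd: "continuous_on {0..1} d"
    unfolding u_def d_def using p q1 by (intro continuous_intros cont; simp)+
  \<comment> \<open>The two-sided derivative is not controlled at the joint nor at the ends, where
    values outside the unit interval enter. Off these three points \<open>v\<close> is the
    continuous function \<open>d\<close>, which replaces it in every integral.\<close>
  define v where "v t = vector_derivative u (at t)" for t
  have v: "v t = d t" if "t \<in> {0..1}" "t \<notin> {0, 1/2, 1}" for t
    unfolding v_def by (rule vector_derivative_at, rule du) (use that in auto)
  have null: "{0, 1/2, 1::real} \<in> null_sets (lebesgue_on {0..1})"
    by (auto simp: null_sets_restrict_space)
  have ae: "AE t in lebesgue_on {0..1::real}. t \<in> {0..1} \<and> t \<notin> {0, 1/2, 1}"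
    by (rule AE_I'[OF null]) auto
  have vd: "AE t in lebesgue_on {0..1}. v t = d t" using ae by eventually_elim (use v in blast)
  have cont_m: "f \<in> borel_measurable (lebesgue_on {0..1})" if "continuous_on {0..1} f"
    for f :: "real \<Rightarrow> real \<times> real"
    by (rule continuous_imp_measurable_on_sets_lebesgue[OF that]) auto
  have vm: "v \<in> borel_measurable (lebesgue_on {0..1})"
    by (rule measurable_discrete_difference[OF cont_m[OF cd], of "{0,1/2,1}"])
      (use v in \<open>auto simp: sets_restrict_space_iff\<close>)
  \<comment> \<open>The factor 1 is the witness for the scaling in \<open>Orlicz\<close>.\<close>
  have bounded: "(\<integral>\<^sup>+t. ennreal (G (1 *\<^sub>R f t)) \<partial>lebesgue_on {0..1}) < \<infinity>"
    if "continuous_on {0..1} f" for f :: "real \<Rightarrow> real \<times> real"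
  proof -
    have "continuous_on {0..1} (\<lambda>t. G (f t))"
      by (rule continuous_on_compose2[OF contG that]) auto
    then have "integrable (lebesgue_on {0..1}) (\<lambda>t. G (f t))" by (rule continuous_imp_integrable_real)
    then show ?thesis by (subst nn_integral_eq_integral) (auto simp: G0)
  qed
  obtain M where M: "\<And>t. t \<in> {0..1} \<Longrightarrow> norm (d t) \<le> M"
    using compact_imp_bounded[OF compact_continuous_image[OF cd]] unfolding bounded_iff by blast
  have "(max M 0)-lipschitz_on {0..1} u"
    by (rule piecewise_C1_imp_lipschitz_on[of "{1/2}" 0 1 u d]) (use cu du M in \<open>auto simp: le_max_iff_disj\<close>)
  then have ac: "absolutely_continuous_on {0..1} u" by (rule lipschitz_imp_absolutely_continuous_on)
  have mem: "u \<in> Sobolev_Orlicz_periodic G"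
    unfolding Sobolev_Orlicz_periodic_def mem_Collect_eq v_def[symmetric]
  proof (intro conjI)
    show "u \<in> Orlicz G"
      unfolding Orlicz_def using bounded[OF cu] cont_m[OF cu] zero_less_one by blast
    have "(\<integral>\<^sup>+t. ennreal (G (1 *\<^sub>R v t)) \<partial>lebesgue_on {0..1}) = (\<integral>\<^sup>+t. ennreal (G (1 *\<^sub>R d t)) \<partial>lebesgue_on {0..1})"
      by (rule nn_integral_cong_AE) (use vd in eventually_elim, simp)
    with bounded[OF cd] have "(\<integral>\<^sup>+t. ennreal (G (1 *\<^sub>R v t)) \<partial>lebesgue_on {0..1}) < \<infinity>" by simp
    then show "v \<in> Orlicz G"
      unfolding Orlicz_def using vm zero_less_one by blast
    show "AE t in lebesgue_on {0..1}. u differentiable (at t)"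
      using ae
    proof eventually_elim
      case (elim t)
      then show ?case using differentiableI_vector[OF du[of t]] by auto
    qed
    show "u 0 = u 1" using bd by (simp add: u_def)
  qed (rule ac)
  have nonconst: "\<not> u constant_on {0..1}"
  proof
    assume "u constant_on {0..1}"
    then have "u 0 = u (1/2)" unfolding constant_on_def by force
    then show False using bd alpha by (simp add: u_def)
  qed
  \<comment> \<open>The means of \<open>|S|^p\<close> and \<open>|V|^q\<close> come without
    computing any integral of a power: \<open>(S V)' = k |V|^q - k (p - 1) |S|^p\<close>, the
    Pythagorean identity eliminates \<open>V\<close>, and \<open>S V\<close> vanishes at both
    ends.\<close>
  have "((\<lambda>t. k * (1 - p * \<bar>S t\<bar> powr p)) has_integral S 1 * V 1 - S 0 * V 0) {0..1}"
  proof (rule fundamental_theorem_of_calculus_interior_strong[of "{1/2}"])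
    show "continuous_on {0..1} (\<lambda>t. S t * V t)" by (intro continuous_intros cont)
    fix t :: real assume t: "t \<in> {0<..<1} - {1/2}"
    have "((\<lambda>t. S t * V t) has_real_derivative k * (1 - p * \<bar>S t\<bar> powr p)) (at t)"
    proof (rule DERIV_cong[OF DERIV_mult[OF dS[OF t] dV[OF t]]])
      have "k * sgn_powr (V t) (q - 1) * V t + - k * (p - 1) * sgn_powr (S t) (p - 1) * S t
        = k * (V t * sgn_powr (V t) (q - 1)) - k * (p - 1) * (S t * sgn_powr (S t) (p - 1))"
        by (simp add: algebra_simps)
      also have "\<dots> = k * (1 - p * \<bar>S t\<bar> powr p)"
        unfolding sgn_powr_mult_self using id[of t] by algebra
      finally show "k * sgn_powr (V t) (q - 1) * V t + - k * (p - 1) * sgn_powr (S t) (p - 1) * S t = k * (1 - p * \<bar>S t\<bar> powr p)" .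
    qed
    then show "((\<lambda>t. S t * V t) has_vector_derivative k * (1 - p * \<bar>S t\<bar> powr p)) (at t)"
      by (simp add: has_real_derivative_iff_has_vector_derivative)
  qed auto
  then have "((\<lambda>t. k * (1 - p * \<bar>S t\<bar> powr p)) has_integral 0) {0..1}" by (simp add: bd)
  note mean_zero = has_integral_mult_right[OF this, of "- 1 / (k * p)"]
  have "((\<lambda>t. \<bar>S t\<bar> powr p - 1 / p) has_integral 0) {0..1}"
  proof -
    have "- 1 / (k * p) * (k * (1 - p * x)) = x - 1 / p" for x
      using k p by (simp add: field_simps)
    with mean_zero show ?thesis by (simp only: mult_zero_right)
  qed
  from has_integral_add[OF this has_integral_const_real[of "1/p" 0 1]]
  have Sp: "((\<lambda>t. \<bar>S t\<bar> powr p) has_integral 1 / p) {0..1}" by simp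
  have "((\<lambda>t. 1 - \<bar>S t\<bar> powr p) has_integral 1 - 1 / p) {0..1}"
    using has_integral_diff[OF has_integral_const_real[of 1 0 1] Sp] by simp
  then have Vq: "((\<lambda>t. \<bar>V t\<bar> powr q) has_integral (p - 1) / p) {0..1}"
  proof -
    have "(\<lambda>t. 1 - \<bar>S t\<bar> powr p) = (\<lambda>t. \<bar>V t\<bar> powr q)" using id by (simp add: fun_eq_iff algebra_simps)
    moreover have "1 - 1 / p = (p - 1) / p" using p by (simp add: field_simps)
    ultimately show ?thesis using \<open>((\<lambda>t. 1 - \<bar>S t\<bar> powr p) has_integral 1 - 1 / p) {0..1}\<close> by simp
  qed
  have LINT: "(LINT t|lebesgue_on {0..1}. f t) = x"
    if "continuous_on {0..1} f" "(f has_integral x) {0..1}" for f :: "real \<Rightarrow> real" and x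
    using lebesgue_integral_eq_integral[OF continuous_imp_integrable_real[OF that(1)]] that(2)
    by (simp add: integral_unique)
  have Jd: "Jmap (d t) \<bullet> u t = - (k * \<alpha> * (p - 1)) * \<bar>S t\<bar> powr p + - (k * \<alpha>) * \<bar>V t\<bar> powr q" for t
    unfolding sgn_powr_mult_self[symmetric]
    by (simp add: Jmap_def d_def u_def inner_prod_def algebra_simps)
  have cJ: "continuous_on {0..1} (\<lambda>t. Jmap (d t) \<bullet> u t)"
    unfolding Jd using p q1 by (intro continuous_intros continuous_on_powr' cont) auto
  have "((\<lambda>t. Jmap (d t) \<bullet> u t) has_integral
      - (k * \<alpha> * (p - 1)) * (1 / p) + - (k * \<alpha>) * ((p - 1) / p)) {0..1}"
    unfolding Jd by (intro has_integral_add has_integral_mult_right Sp Vq)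
  from LINT[OF cJ this] have numd: "(LINT t|lebesgue_on {0..1}. Jmap (d t) \<bullet> u t) = - (2 * (k * \<alpha>) * ((p - 1) / p))"
    using p by (simp add: algebra_simps diff_divide_distrib)
  have num: "(LINT t|lebesgue_on {0..1}. Jmap (v t) \<bullet> u t) = - (2 * (k * \<alpha>) * ((p - 1) / p))"
    unfolding numd[symmetric]
    by (rule integral_discrete_difference[of "{0, 1/2, 1}"])
      (use v in \<open>auto simp: sets_restrict_space_iff emeasure_restrict_space\<close>)
  have Gd: "G (d t) = \<mu> / p * \<bar>V t\<bar> powr q + \<mu> * (p - 1) / q * \<bar>S t\<bar> powr p" for t
  proof -
    have "\<bar>\<alpha> * (k * sgn_powr (V t) (q - 1))\<bar> powr p = \<mu> * \<bar>V t\<bar> powr q"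
      using alpha k by (simp add: abs_mult mult.assoc[symmetric] powr_mult powr_powr pq ak[symmetric])
    moreover have "\<bar>- k * (p - 1) * sgn_powr (S t) (p - 1)\<bar> powr q = (k powr q * (p - 1) powr q) * \<bar>S t\<bar> powr p"
      using k p by (simp add: abs_mult powr_mult powr_powr pq)
    moreover have "k powr q * (p - 1) powr q = \<mu> * (p - 1)"
      using p by (simp add: \<mu>_def powr_diff)
    ultimately show ?thesis by (simp add: G d_def)
  qed
  have cG: "continuous_on {0..1} (\<lambda>t. G (d t))"
    by (rule continuous_on_compose2[OF contG cd]) auto
  have "((\<lambda>t. G (d t)) has_integral \<mu> / p * ((p - 1) / p) + \<mu> * (p - 1) / q * (1 / p)) {0..1}"
    unfolding Gd by (intro has_integral_add has_integral_mult_right Sp Vq)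
  moreover have "\<mu> / p * ((p - 1) / p) + \<mu> * (p - 1) / q * (1 / p) = \<mu> * ((p - 1) / p)"
  proof -
    have "\<mu> / p * ((p - 1) / p) + \<mu> * (p - 1) / q * (1 / p) = \<mu> * ((p - 1) / p) * (1 / p + 1 / q)"
      using p q1 by (simp add: field_simps)
    then show ?thesis using p by (simp add: qinv field_simps)
  qed
  ultimately have denL: "(LINT t|lebesgue_on {0..1}. G (d t)) = \<mu> * ((p - 1) / p)"
    using LINT[OF cG] by simp
  have "(\<integral>\<^sup>+t. ennreal (G (v t)) \<partial>lebesgue_on {0..1}) = (\<integral>\<^sup>+t. ennreal (G (d t)) \<partial>lebesgue_on {0..1})"
    by (rule nn_integral_cong_AE) (use vd in eventually_elim, simp)
  also have "\<dots> = ennreal (\<mu> * ((p - 1) / p))"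
    unfolding denL[symmetric]
    by (rule nn_integral_eq_integral[OF continuous_imp_integrable_real[OF cG]]) (simp add: G0)
  finally have den: "enn2ereal (\<integral>\<^sup>+t. ennreal (G (v t)) \<partial>lebesgue_on {0..1}) = ereal (\<mu> * ((p - 1) / p))"
    using p mu by (simp add: enn2ereal_ennreal)
  \<comment> \<open>The factor \<open>(p - 1) / p\<close> is common to numerator and denominator.
    With \<open>k * \<alpha> = \<mu> powr (1/p)\<close> the rest is
    \<open>2 / \<mu> powr (1/q)\<close>, the constant of the calibration.\<close>
  have "2 * (k * \<alpha>) / \<mu> = 2 / \<mu> powr (1/q)"
  proof -
    have "\<mu> = \<mu> powr (1/p) * \<mu> powr (1/q)"
      using mu p by (simp add: qinv flip: powr_add add_divide_distrib)
    then have "2 * (k * \<alpha>) / \<mu> = 2 * \<mu> powr (1/p) / (\<mu> powr (1/p) * \<mu> powr (1/q))"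
      using k by (simp add: \<alpha>_def)
    then show ?thesis using mu by simp
  qed
  also have "\<mu> powr (1/q) = k * (p - 1) powr (1/p)"
  proof -
    have "\<mu> powr (1/q) = k powr (q * (1/q)) * (p - 1) powr ((q - 1) * (1/q))"
      unfolding \<mu>_def using p k by (simp add: powr_mult powr_powr)
    then show ?thesis using k q1 q1p by simp
  qed
  also have "2 / (k * (p - 1) powr (1/p)) = p * sin (pi / p) / (2 * pi * (p - 1) powr (1 / p))"
    using p sin by (simp add: k_def field_simps)
  finally have ratio: "2 * (k * \<alpha>) / \<mu> = p * sin (pi / p) / (2 * pi * (p - 1) powr (1 / p))" .
  have "ereal (LINT t|lebesgue_on {0..1}. Jmap (v t) \<bullet> u t) /
         enn2ereal (\<integral>\<^sup>+t. ennreal (G (v t)) \<partial>lebesgue_on {0..1}) = ereal (- (2 * (k * \<alpha>) / \<mu>))"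
    unfolding num den using p mu by simp
  then show thesis using that[OF mem nonconst] unfolding v_def ratio by simp
qed

theorem theorem3p12:
  fixes p q :: real and G :: "real \<times> real \<Rightarrow> real"
  assumes "1 < p"
    and "q = p / (p - 1)"
    and "G = (\<lambda>(u1, u2). \<bar>u1\<bar> powr p / p + \<bar>u2\<bar> powr q / q)"
  shows "C_const G = ereal (p * sin (pi / p) / (2 * pi * (p - 1) powr (1 / p)))"
proof -
  obtain u where u: "u \<in> Sobolev_Orlicz_periodic G" "\<not> u constant_on {0..1}"
    "ereal (LINT t|lebesgue_on {0..1}. Jmap (vector_derivative u (at t)) \<bullet> u t) /
         enn2ereal (\<integral>\<^sup>+t. ennreal (G (vector_derivative u (at t))) \<partial>lebesgue_on {0..1}) =
     - ereal (p * sin (pi / p) / (2 * pi * (p - 1) powr (1 / p)))"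
    using Sobolev_Orlicz_quotient_attained[OF assms] by blast
  have "(INF u \<in> {u \<in> Sobolev_Orlicz_periodic G. \<not> u constant_on {0..1}}.
         ereal (LINT t|lebesgue_on {0..1}. Jmap (vector_derivative u (at t)) \<bullet> u t) /
         enn2ereal (\<integral>\<^sup>+t. ennreal (G (vector_derivative u (at t))) \<partial>lebesgue_on {0..1}))
    = - ereal (p * sin (pi / p) / (2 * pi * (p - 1) powr (1 / p)))"
    (is "(INF u \<in> ?U. ?Q u) = ?L")
  proof (rule antisym)
    show "(INF u \<in> ?U. ?Q u) \<le> ?L"
      by (rule INF_lower2[of u]) (use u in auto)
    show "?L \<le> (INF u \<in> ?U. ?Q u)"
      by (rule INF_greatest) (use Sobolev_Orlicz_quotient_ge[OF assms] in auto)
  qed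
  then show ?thesis unfolding C_const_def by simp
qed

end
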